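(* Let $\bar z(\cdot)=(\bar x(\cdot),\bar u(\cdot),\bar a(\cdot))$ be a relaxed intermediate local minimizer (r.i.l.m.) of problem $(P)$ described in the context, and suppose that (H1)--(H4) and the mesh assumption (D) of the context hold along $\bar z(\cdot)$. Then for all sufficiently large $k\in\mathbb N$ the discrete problem $(P_k)$ defined in the context admits an optimal solution $\bar z^k(\cdot)$.
   Context: Data. $T>0$, $x_0\in\mathbb R^n$, $0<r_1\le r_2$ are fixed; $g_1,\ldots,g_m:\mathbb R^n\to\mathbb R$ are convex $\mathcal C^2$-smooth, $C_i:=\{x\,|\,g_i(x)\ge0\}$, $C:=\bigcap_{i=1}^mC_i$; $f:\mathbb R^n\times\mathbb R^d\to\mathbb R^n$; $F(x,u,a):=N(x-u;C)+f(x,a)$, where $N(\bar x;\Omega):=\{v\,|\,\exists x_k\to\bar x,\ w_k\in\Pi(x_k;\Omega),\ \alpha_k\ge0$ with $\alpha_k(x_k-w_k)\to v\}$ is the limiting normal cone ($\Pi$ the Euclidean projector; $\emptyset$ if $\bar x\notin\Omega$), which for $C$ agrees with the proximal normal cone under (H2),(H3). Problem $(P)$: minimize $J[z]:=\varphi(x(T))+\int_0^T\ell(t,z(t),\dot z(t))\,dt$ over $z(\cdot)=(x(\cdot),u(\cdot),a(\cdot))\in W^{1,2}([0,T];\mathbb R^{2n+d})$ subject to $-\dot x(t)\in F(z(t))$ a.e. $t\in[0,T]$, $x(0)=x_0$, $x_0-u(0)\in C$, and $r_1\le\|u(t)\|\le r_2$ on $[0,T]$. Put $C(t):=C+u(t)$.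 R.i.l.m. Let $\hat\ell_F(t,x,u,a,\cdot,\cdot,\cdot)$ be the convexification (largest l.s.c. convex function majorized by $\ell(t,x,u,a,\cdot,\cdot,\cdot)$) in the velocity variables $(\dot x,\dot u,\dot a)$ on the set where $-\dot x\in F(x,u,a)$, with $\hat\ell_F:=\infty$ off this set, and let $\hat J$ be $J$ with $\hat\ell_F$ in place of $\ell$. Then $\bar z(\cdot)$ is an r.i.l.m. for $(P)$ if it is feasible for $(P)$, $J[\bar z]=\hat J[\bar z]$, and there is $\varepsilon>0$ such that $J[\bar z]\le J[z]$ for every feasible $z(\cdot)$ of $(P)$ with $\|z(t)-\bar z(t)\|<\varepsilon$ on $[0,T]$ and $\int_0^T\|\dot z(t)-\dot{\bar z}(t)\|^2dt<\varepsilon$. Assumptions. (H1) $f$ is continuous; for every $\varepsilon>0$ there is $K>0$ with $\|f(x,a)-f(y,a)\|\le K\|x-y\|$ for all $x,y\in B(0,\varepsilon)$, $a\in\mathbb R^d$; there is $M>0$ with $\|f(x,a)\|\le M(1+\|x\|)$ for all $x\in\bigcup_{t}C(t)$ (for the controls $u$ under consideration), $a\in\mathbb R^d$. (H2) There are $c>0$, open sets $V_i\supset\{x\,|\,\mathrm{dist}(x;C_i)<c\}$ and $M_1,M_2,M_3>0$ such that each $g_i$ is $\mathcal C^2$-smooth with $M_1\le\|\nabla g_i(x)\|\le M_2$, $\|\nabla^2g_i(x)\|\le M_3$ on $V_i$. (H3) There are $\beta,\rho>0$ with $\sum_{i\in I_\rho(x)}\lambda_i\|\nabla g_i(x)\|\le\beta\|\sum_{i\in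 I_\rho(x)}\lambda_i\nabla g_i(x)\|$ for all $x\in C$, $\lambda_i\ge0$, where $I_\rho(x):=\{i\,|\,g_i(x)\le\rho\}$. (H4) $\varphi:\mathbb R^n\to(-\infty,\infty]$ is l.s.c.; $\ell:[0,T]\times\mathbb R^{4n+2d}\to(-\infty,\infty]$ has $\ell(t,\cdot)$ l.s.c. for a.e. $t$, bounded from below on bounded sets, and $t\mapsto\ell(t,z(t),\dot z(t))$ summable for each feasible $z(\cdot)$. (D) For the uniform partitions $0=t^k_0<\ldots<t^k_k=T$ with step $h_k\downarrow0$, the inclusion $-\dot{\bar x}(t)\in F(\bar z(t))$ holds at $t=t^k_j$, $j=0,\ldots,k-1$ (right derivative at $0$), and for some $\mu>0$ independent of $k$: $\sum_{j=0}^{k-1}\|\frac{\bar x(t^k_{j+1})-\bar x(t^k_j)}{h_k}-\dot{\bar x}(t^k_j)\|\le\mu$, $\|\frac{\bar u(t^k_1)-\bar u(t^k_0)}{h_k}\|\le\mu$, $\sum_{j=0}^{k-2}\|\frac{\bar u(t^k_{j+2})-\bar u(t^k_{j+1})}{h_k}-\frac{\bar u(t^k_{j+1})-\bar u(t^k_j)}{h_k}\|\le\mu$. Approximation constants. Under (H1)--(H3) and (D) it is known that there are piecewise linear $z^k=(x^k,u^k,a^k)$ on $[0,T]$ with $z^k(0)=\bar z(0)$ and positive numbers $\varepsilon_k\le2h_k\mu e^K\downarrow0$ ($K$ the Lipschitz constant in (H1) for a ball containing the trajectories involved) such that $r_1-\varepsilon_k\le\|u^k(t^k_j)\|\le r_2+\varepsilon_k$,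 $x^k(t^k_{j+1})\in x^k(t^k_j)-h_kF(z^k(t^k_j))$, $x^k(t^k_j)-u^k(t^k_j)\in C$ for $j=0,\ldots,k$, $z^k\to\bar z$ in $W^{1,2}$, and, with $\tilde\mu:=\max\{3\mu(1+4KT)e^K,4\mu(e^K+1)\}$, $\|(u^k(t^k_1)-u^k(t^k_0))/h_k\|\le\tilde\mu$ and $\mathrm{var}(\dot u^k;[0,T])\le\tilde\mu$. These $\varepsilon_k$ and $\tilde\mu$ are used below. Problem $(P_k)$: with $\varepsilon$ from the definition of r.i.l.m. for $\bar z$, minimize $$\begin{aligned}J_k[z^k]:=\ &\varphi(x^k_k)+h_k\sum_{j=0}^{k-1}\ell\Big(t^k_j,x^k_j,u^k_j,a^k_j,\tfrac{x^k_{j+1}-x^k_j}{h_k},\tfrac{u^k_{j+1}-u^k_j}{h_k},\tfrac{a^k_{j+1}-a^k_j}{h_k}\Big)+S_k(z^k)\\&+\mathrm{dist}^2\Big(\big\|\tfrac{u^k_1-u^k_0}{h_k}\big\|;(-\infty,\tilde\mu]\Big)+\mathrm{dist}^2\Big(\sum_{j=0}^{k-2}\big\|\tfrac{u^k_{j+2}-2u^k_{j+1}+u^k_j}{h_k}\big\|;(-\infty,\tilde\mu]\Big),\end{aligned}$$ $$S_k(z^k):=\sum_{j=0}^{k-1}\int_{t^k_j}^{t^k_{j+1}}\Big(\big\|\tfrac{x^k_{j+1}-x^k_j}{h_k}-\dot{\bar x}(t)\big\|^2+\big\|\tfrac{u^k_{j+1}-u^k_j}{h_k}-\dot{\bar u}(t)\big\|^2+\big\|\tfrac{a^k_{j+1}-a^k_j}{h_k}-\dot{\bar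 a}(t)\big\|^2\Big)dt,$$ over $z^k=(x^k_0,\ldots,x^k_k,u^k_0,\ldots,u^k_k,a^k_0,\ldots,a^k_k)$ subject to: $x^k_{j+1}\in x^k_j-h_kF(x^k_j,u^k_j,a^k_j)$ for $j=0,\ldots,k-1$ with $(x^k_0,u^k_0,a^k_0)=(x_0,\bar u(0),\bar a(0))$; $g_i(x^k_k-u^k_k)\ge0$ for $i=1,\ldots,m$; $r_1-\varepsilon_k\le\|u^k_j\|\le r_2+\varepsilon_k$ for $j=0,\ldots,k$; $\|(x^k_j,u^k_j,a^k_j)-\bar z(t^k_j)\|\le\varepsilon/2$ for $j=0,\ldots,k-1$; $S_k(z^k)\le\varepsilon/2$; $\|\frac{u^k_1-u^k_0}{h_k}\|\le\tilde\mu+1$ and $\sum_{j=0}^{k-2}\|\frac{u^k_{j+2}-2u^k_{j+1}+u^k_j}{h_k}\|\le\tilde\mu+1$.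
   Formalization: Added assumption: ℓ(t,·) is l.s.c. at every mesh point t=t^k_j (j<k, k≥1), not only for a.e. t; without it the claim fails, e.g. when ℓ(0,·) is not l.s.c., since the cost of (P_k) evaluates ℓ at the mesh points. *)

theory Defs
  imports "HOL-Analysis.Analysis"
begin

section \<open>Nonsmooth and variational notions\<close>

text \<open>The set-valued Euclidean projector (the library's \<open>closest_point\<close> selects a single point).\<close>

definition projector :: "'a::euclidean_space set \<Rightarrow> 'a \<Rightarrow> 'a set" where
  "projector \<Omega> x = {w \<in> \<Omega>. dist x w = infdist x \<Omega>}"

definition normal_cone :: "'a::euclidean_space set \<Rightarrow> 'a \<Rightarrow> 'a set" where
  "normal_cone \<Omega> xbar =
     (if xbar \<in> \<Omega> then
        {v. \<exists>xs ws \<alpha>. xs \<longlonglongrightarrow> xbar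
             \<and> (\<forall>k. ws k \<in> projector \<Omega> (xs k)) \<and> (\<forall>k. \<alpha> k \<ge> (0::real))
             \<and> (\<lambda>k. \<alpha> k *\<^sub>R (xs k - ws k)) \<longlonglongrightarrow> v}
      else {})"

definition lsc :: "('a::topological_space \<Rightarrow> ereal) \<Rightarrow> bool" where
  "lsc h \<longleftrightarrow> (\<forall>x. h x \<le> Liminf (nhds x) h)"

text \<open>Convexity of an extended-real-valued function: its epigraph, a subset of \<open>'a \<times> real\<close>,
  is convex.\<close>

definition convex_ereal :: "('a::real_vector \<Rightarrow> ereal) \<Rightarrow> bool" where
  "convex_ereal h \<longleftrightarrow> convex {(v, r::real). h v \<le> ereal r}"

definition grad :: "('a::euclidean_space \<Rightarrow> real) \<Rightarrow> 'a \<Rightarrow> 'a" where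
  "grad h x = (THE D. GDERIV h x :> D)"

definition hess :: "(real^'n \<Rightarrow> real) \<Rightarrow> real^'n \<Rightarrow> real^'n^'n" where
  "hess h x = matrix (frechet_derivative (grad h) (at x))"

definition C2_on :: "(real^'n) set \<Rightarrow> (real^'n \<Rightarrow> real) \<Rightarrow> bool" where
  "C2_on V h \<longleftrightarrow> open V
     \<and> (\<forall>x\<in>V. (\<exists>D. GDERIV h x :> D) \<and> grad h differentiable (at x))
     \<and> continuous_on V (hess h)"

text \<open>\<open>\<integral>f = \<integral>f\<^sup>+ - \<integral>f\<^sup>-\<close>; note \<open>\<infinity> - \<infinity> = \<infinity>\<close> on \<^typ>\<open>ereal\<close>.\<close>

definition ereal_integral :: "'b measure \<Rightarrow> ('b \<Rightarrow> ereal) \<Rightarrow> ereal" where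
  "ereal_integral M h =
     enn2ereal (\<integral>\<^sup>+ t. e2ennreal (h t) \<partial>M) - enn2ereal (\<integral>\<^sup>+ t. e2ennreal (- h t) \<partial>M)"

definition ereal_summable :: "'b measure \<Rightarrow> ('b \<Rightarrow> ereal) \<Rightarrow> bool" where
  "ereal_summable M h \<longleftrightarrow> h \<in> borel_measurable M \<and> (\<integral>\<^sup>+ t. e2ennreal \<bar>h t\<bar> \<partial>M) < \<infinity>"

section \<open>Functions on the time interval\<close>

text \<open>Time derivative on \<open>[0,T]\<close>: two-sided inside, one-sided at the endpoints; an arbitrary value
  where the derivative does not exist.\<close>

definition time_deriv :: "real \<Rightarrow> (real \<Rightarrow> 'a::real_normed_vector) \<Rightarrow> real \<Rightarrow> 'a" where
  "time_deriv T z t = vector_derivative z (at t within {0..T})"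

text \<open>\<open>W\<^sup>1\<^sup>,\<^sup>2([0,T])\<close>, identified as usual with the indefinite integrals of square integrable
  functions. That the integrand is the a.e. derivative is Lebesgue's differentiation theorem; it is
  stated as part of the definition.\<close>

definition W12 :: "real \<Rightarrow> (real \<Rightarrow> 'a::euclidean_space) \<Rightarrow> bool" where
  "W12 T z \<longleftrightarrow>
     (\<exists>v. v \<in> borel_measurable (lebesgue_on {0..T})
        \<and> integrable (lebesgue_on {0..T}) (\<lambda>t. (norm (v t))\<^sup>2)
        \<and> (AE t in lebesgue_on {0..T}. (z has_vector_derivative v t) (at t within {0..T}))
        \<and> (\<forall>t\<in>{0..T}. z t = z 0 + (LINT s|lebesgue_on {0..t}. v s)))"

definition W12_dist_sq :: "real \<Rightarrow> (real \<Rightarrow> 'a::euclidean_space) \<Rightarrow> (real \<Rightarrow> 'a) \<Rightarrow> real" where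
  "W12_dist_sq T z w =
     (LINT t|lebesgue_on {0..T}. (norm (z t - w t))\<^sup>2)
     + (LINT t|lebesgue_on {0..T}. (norm (time_deriv T z t - time_deriv T w t))\<^sup>2)"

definition total_variation :: "real set \<Rightarrow> (real \<Rightarrow> 'a::real_normed_vector) \<Rightarrow> ereal" where
  "total_variation S h =
     (SUP (N, s) \<in> {(N::nat, s::nat \<Rightarrow> real). strict_mono_on {..N} s \<and> s ` {..N} \<subseteq> S}.
        ereal (\<Sum>i<N. norm (h (s (Suc i)) - h (s i))))"

text \<open>The total variation of \<open>time_deriv T u\<close> over the points where the derivative exists, so that the
  mesh points of a piecewise linear \<open>u\<close> do not matter.\<close>

definition var_dot :: "real \<Rightarrow> (real \<Rightarrow> 'a::real_normed_vector) \<Rightarrow> ereal" where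
  "var_dot T u =
     total_variation {t \<in> {0..T}. u differentiable (at t within {0..T})} (time_deriv T u)"

definition mesh_step :: "real \<Rightarrow> nat \<Rightarrow> real" where
  "mesh_step T k = T / real k"

definition mesh :: "real \<Rightarrow> nat \<Rightarrow> nat \<Rightarrow> real" where
  "mesh T k j = real j * mesh_step T k"

definition piecewise_linear :: "real \<Rightarrow> nat \<Rightarrow> (real \<Rightarrow> 'a::real_vector) \<Rightarrow> bool" where
  "piecewise_linear T k z \<longleftrightarrow>
     (\<forall>j<k. \<forall>t\<in>{mesh T k j..mesh T k (Suc j)}.
        z t = z (mesh T k j)
              + ((t - mesh T k j) / mesh_step T k) *\<^sub>R (z (mesh T k (Suc j)) - z (mesh T k j)))"

section \<open>The controlled sweeping process\<close>

text \<open>States \<open>z = (x, u, a)\<close> and velocities \<open>(x', u', a')\<close> both live in this type, whose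
  product norm is Euclidean.\<close>

type_synonym ('n, 'd) state = "(real^'n) \<times> (real^'n) \<times> (real^'d)"

abbreviation x_of :: "('n::finite, 'd::finite) state \<Rightarrow> real^'n" where "x_of z \<equiv> fst z"
abbreviation u_of :: "('n::finite, 'd::finite) state \<Rightarrow> real^'n" where "u_of z \<equiv> fst (snd z)"
abbreviation a_of :: "('n::finite, 'd::finite) state \<Rightarrow> real^'d" where "a_of z \<equiv> snd (snd z)"

text \<open>The data \<open>T\<close>, \<open>x\<^sub>0\<close>, \<open>r\<^sub>1\<close>, \<open>r\<^sub>2\<close>, \<open>m\<close>, \<open>g\<^sub>1, \<dots>, g\<^sub>m\<close>, \<open>f\<close>, \<open>\<phi>\<close>, \<open>\<ell>\<close>. Only
  \<open>con P i\<close> with \<open>1 \<le> i \<le> ncon P\<close> and \<open>run_cost P t\<close> with \<open>0 \<le> t \<le> horizon P\<close> are relevant.\<close>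

record ('n, 'd) sweeping =
  horizon :: real
  x_init :: "real^'n"
  r_min :: real
  r_max :: real
  ncon :: nat
  con :: "nat \<Rightarrow> real^'n \<Rightarrow> real"
  drift :: "real^'n \<Rightarrow> real^'d \<Rightarrow> real^'n"
  term_cost :: "real^'n \<Rightarrow> ereal"
  run_cost :: "real \<Rightarrow> ('n, 'd) state \<Rightarrow> ('n, 'd) state \<Rightarrow> ereal"

definition standing :: "('n::finite, 'd::finite) sweeping \<Rightarrow> bool" where
  "standing P \<longleftrightarrow> 0 < horizon P \<and> 0 < r_min P \<and> r_min P \<le> r_max P \<and> 1 \<le> ncon P
     \<and> (\<forall>i\<in>{1..ncon P}. convex_on UNIV (con P i) \<and> C2_on UNIV (con P i))"

definition C_comp :: "('n::finite, 'd::finite) sweeping \<Rightarrow> nat \<Rightarrow> (real^'n) set" where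
  "C_comp P i = {x. con P i x \<ge> 0}"

definition C_set :: "('n::finite, 'd::finite) sweeping \<Rightarrow> (real^'n) set" where
  "C_set P = (\<Inter>i\<in>{1..ncon P}. C_comp P i)"

definition F_map :: "('n::finite, 'd::finite) sweeping \<Rightarrow> ('n, 'd) state \<Rightarrow> (real^'n) set" where
  "F_map P z = {v + drift P (x_of z) (a_of z) | v. v \<in> normal_cone (C_set P) (x_of z - u_of z)}"

definition feasible :: "('n::finite, 'd::finite) sweeping \<Rightarrow> (real \<Rightarrow> ('n, 'd) state) \<Rightarrow> bool" where
  "feasible P z \<longleftrightarrow> W12 (horizon P) z
     \<and> (AE t in lebesgue_on {0..horizon P}. - x_of (time_deriv (horizon P) z t) \<in> F_map P (z t))
     \<and> x_of (z 0) = x_init P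
     \<and> x_init P - u_of (z 0) \<in> C_set P
     \<and> (\<forall>t\<in>{0..horizon P}. r_min P \<le> norm (u_of (z t)) \<and> norm (u_of (z t)) \<le> r_max P)"

definition cost_with ::
    "('n::finite, 'd::finite) sweeping \<Rightarrow> (real \<Rightarrow> ('n, 'd) state \<Rightarrow> ('n, 'd) state \<Rightarrow> ereal)
      \<Rightarrow> (real \<Rightarrow> ('n, 'd) state) \<Rightarrow> ereal" where
  "cost_with P L z = term_cost P (x_of (z (horizon P)))
     + ereal_integral (lebesgue_on {0..horizon P}) (\<lambda>t. L t (z t) (time_deriv (horizon P) z t))"

definition J_cost :: "('n::finite, 'd::finite) sweeping \<Rightarrow> (real \<Rightarrow> ('n, 'd) state) \<Rightarrow> ereal" where
  "J_cost P z = cost_with P (run_cost P) z"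

text \<open>The largest l.s.c. convex function majorized by the running cost on the set of admissible
  velocities is the supremum of all l.s.c. convex functions so majorized.\<close>

definition relaxed_cost ::
    "('n::finite, 'd::finite) sweeping \<Rightarrow> real \<Rightarrow> ('n, 'd) state \<Rightarrow> ('n, 'd) state \<Rightarrow> ereal" where
  "relaxed_cost P t z v =
     (if - x_of v \<in> F_map P z
      then (SUP h \<in> {h. lsc h \<and> convex_ereal h
                        \<and> (\<forall>w. - x_of w \<in> F_map P z \<longrightarrow> h w \<le> run_cost P t z w)}. h v)
      else \<infinity>)"

definition J_relaxed :: "('n::finite, 'd::finite) sweeping \<Rightarrow> (real \<Rightarrow> ('n, 'd) state) \<Rightarrow> ereal" where
  "J_relaxed P z = cost_with P (relaxed_cost P) z"

definition rilm ::
    "('n::finite, 'd::finite) sweeping \<Rightarrow> real \<Rightarrow> (real \<Rightarrow> ('n, 'd) state) \<Rightarrow> bool" where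
  "rilm P \<epsilon> zbar \<longleftrightarrow> feasible P zbar \<and> J_cost P zbar = J_relaxed P zbar \<and> 0 < \<epsilon>
     \<and> (\<forall>z. feasible P z
           \<and> (\<forall>t\<in>{0..horizon P}. norm (z t - zbar t) < \<epsilon>)
           \<and> (LINT t|lebesgue_on {0..horizon P}.
                 (norm (time_deriv (horizon P) z t - time_deriv (horizon P) zbar t))\<^sup>2) < \<epsilon>
           \<longrightarrow> J_cost P zbar \<le> J_cost P z)"

section \<open>Assumptions\<close>

definition lipschitz_const_on ::
    "('n::finite, 'd::finite) sweeping \<Rightarrow> (real^'n) set \<Rightarrow> real \<Rightarrow> bool" where
  "lipschitz_const_on P S K \<longleftrightarrow> 0 < K
     \<and> (\<forall>x\<in>S. \<forall>y\<in>S. \<forall>a. norm (drift P x a - drift P y a) \<le> K * norm (x - y))"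

definition H1 :: "('n::finite, 'd::finite) sweeping \<Rightarrow> bool" where
  "H1 P \<longleftrightarrow> continuous_on UNIV (\<lambda>(x, a). drift P x a)
     \<and> (\<forall>\<epsilon>>0. \<exists>K. lipschitz_const_on P (ball 0 \<epsilon>) K)
     \<and> (\<exists>M>0. \<forall>z. feasible P z \<longrightarrow>
          (\<forall>t\<in>{0..horizon P}. \<forall>x\<in>(\<lambda>y. y + u_of (z t)) ` C_set P. \<forall>a.
             norm (drift P x a) \<le> M * (1 + norm x)))"

definition H2 :: "('n::finite, 'd::finite) sweeping \<Rightarrow> bool" where
  "H2 P \<longleftrightarrow> (\<exists>c>0. \<exists>V. \<exists>M1>0. \<exists>M2>0. \<exists>M3>0. \<forall>i\<in>{1..ncon P}.
       open (V i) \<and> {x. infdist x (C_comp P i) < c} \<subseteq> V i \<and> C2_on (V i) (con P i)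
       \<and> (\<forall>x\<in>V i. M1 \<le> norm (grad (con P i) x) \<and> norm (grad (con P i) x) \<le> M2
                  \<and> onorm ((*v) (hess (con P i) x)) \<le> M3))"

definition active :: "('n::finite, 'd::finite) sweeping \<Rightarrow> real \<Rightarrow> real^'n \<Rightarrow> nat set" where
  "active P \<rho> x = {i \<in> {1..ncon P}. con P i x \<le> \<rho>}"

definition H3 :: "('n::finite, 'd::finite) sweeping \<Rightarrow> bool" where
  "H3 P \<longleftrightarrow> (\<exists>\<beta>>0. \<exists>\<rho>>0. \<forall>x\<in>C_set P. \<forall>c. (\<forall>i. c i \<ge> 0) \<longrightarrow>
       (\<Sum>i\<in>active P \<rho> x. c i * norm (grad (con P i) x))
         \<le> \<beta> * norm (\<Sum>i\<in>active P \<rho> x. c i *\<^sub>R grad (con P i) x))"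

definition H4 :: "('n::finite, 'd::finite) sweeping \<Rightarrow> bool" where
  "H4 P \<longleftrightarrow> (\<forall>x. term_cost P x \<noteq> - \<infinity>) \<and> lsc (term_cost P)
     \<and> (\<forall>t\<in>{0..horizon P}. \<forall>z v. run_cost P t z v \<noteq> - \<infinity>)
     \<and> (AE t in lebesgue_on {0..horizon P}. lsc (\<lambda>(z, v). run_cost P t z v))
     \<and> (\<forall>B. bounded B \<longrightarrow>
          (\<exists>b::real. \<forall>t\<in>{0..horizon P}. \<forall>(z, v)\<in>B. ereal b \<le> run_cost P t z v))
     \<and> (\<forall>z. feasible P z \<longrightarrow>
          ereal_summable (lebesgue_on {0..horizon P})
            (\<lambda>t. run_cost P t (z t) (time_deriv (horizon P) z t)))"

text \<open>Lower semicontinuity for a.e. \<open>t\<close> says nothing about the mesh points, which form a null set,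
  whereas the discrete costs evaluate the running cost there (at \<open>t = 0\<close> for every \<open>k\<close>) and need
  not attain their infimum without it.\<close>

definition lsc_at_mesh :: "('n::finite, 'd::finite) sweeping \<Rightarrow> bool" where
  "lsc_at_mesh P \<longleftrightarrow>
     (\<forall>k\<ge>1. \<forall>j<k. lsc (\<lambda>(z, v). run_cost P (mesh (horizon P) k j) z v))"

definition mesh_assm ::
    "('n::finite, 'd::finite) sweeping \<Rightarrow> (real \<Rightarrow> ('n, 'd) state) \<Rightarrow> real \<Rightarrow> bool" where
  "mesh_assm P zbar \<mu> \<longleftrightarrow> 0 < \<mu> \<and>
     (\<forall>k\<ge>1. let T = horizon P; h = mesh_step T k; t = mesh T k;
                x = (\<lambda>s. x_of (zbar s)); u = (\<lambda>s. u_of (zbar s)) in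
        (\<forall>j<k. x differentiable (at (t j) within {0..T}) \<and> - time_deriv T x (t j) \<in> F_map P (zbar (t j)))
        \<and> (\<Sum>j<k. norm ((x (t (j + 1)) - x (t j)) /\<^sub>R h - time_deriv T x (t j))) \<le> \<mu>
        \<and> norm ((u (t 1) - u (t 0)) /\<^sub>R h) \<le> \<mu>
        \<and> (\<Sum>j<k - 1. norm ((u (t (j + 2)) - u (t (j + 1))) /\<^sub>R h
                            - (u (t (j + 1)) - u (t j)) /\<^sub>R h)) \<le> \<mu>)"

section \<open>Approximation constants\<close>

definition mu_tilde :: "real \<Rightarrow> real \<Rightarrow> real \<Rightarrow> real" where
  "mu_tilde T \<mu> K = max (3 * \<mu> * (1 + 4 * K * T) * exp K) (4 * \<mu> * (exp K + 1))"

text \<open>\<open>e k\<close> are constants \<open>\<epsilon>\<^sub>k\<close> as delivered by the strong discrete approximation of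
  \<open>zbar\<close>; \<open>K\<close> is a Lipschitz constant of the drift on a ball containing all the trajectories
  \<open>x\<close> involved.\<close>

definition approximation_constants ::
    "('n::finite, 'd::finite) sweeping \<Rightarrow> (real \<Rightarrow> ('n, 'd) state) \<Rightarrow> real \<Rightarrow> real
      \<Rightarrow> (nat \<Rightarrow> real) \<Rightarrow> bool" where
  "approximation_constants P zbar \<mu> K e \<longleftrightarrow>
     (let T = horizon P in
      \<exists>zz :: nat \<Rightarrow> real \<Rightarrow> ('n, 'd) state.
        (\<exists>R>0. lipschitz_const_on P (ball 0 R) K
           \<and> (\<forall>t\<in>{0..T}. x_of (zbar t) \<in> ball 0 R \<and> (\<forall>k\<ge>1. x_of (zz k t) \<in> ball 0 R)))
        \<and> (\<lambda>k. W12_dist_sq T (zz k) zbar) \<longlonglongrightarrow> 0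
        \<and> (\<forall>k\<ge>1. let h = mesh_step T k; t = mesh T k; z = zz k; u = (\<lambda>s. u_of (z s)) in
             0 < e k \<and> e k \<le> 2 * h * \<mu> * exp K
             \<and> piecewise_linear T k z \<and> z 0 = zbar 0
             \<and> (\<forall>j\<le>k. r_min P - e k \<le> norm (u (t j)) \<and> norm (u (t j)) \<le> r_max P + e k)
             \<and> (\<forall>j<k. x_of (z (t (j + 1))) \<in> (\<lambda>w. x_of (z (t j)) - h *\<^sub>R w) ` F_map P (z (t j)))
             \<and> (\<forall>j\<le>k. x_of (z (t j)) - u (t j) \<in> C_set P)
             \<and> norm ((u (t 1) - u (t 0)) /\<^sub>R h) \<le> mu_tilde T \<mu> K
             \<and> var_dot T u \<le> ereal (mu_tilde T \<mu> K)))"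

section \<open>The discrete problems\<close>

text \<open>A discrete process is given by its nodes \<open>z 0, \<dots>, z k\<close>; the values \<open>z j\<close> with
  \<open>j > k\<close> are irrelevant.\<close>

definition S_disc ::
    "('n::finite, 'd::finite) sweeping \<Rightarrow> (real \<Rightarrow> ('n, 'd) state) \<Rightarrow> nat
      \<Rightarrow> (nat \<Rightarrow> ('n, 'd) state) \<Rightarrow> real" where
  "S_disc P zbar k z =
     (let T = horizon P; h = mesh_step T k; v = time_deriv T zbar in
      \<Sum>j<k. LINT t|lebesgue_on {mesh T k j..mesh T k (j + 1)}.
         (norm ((x_of (z (j + 1)) - x_of (z j)) /\<^sub>R h - x_of (v t)))\<^sup>2
         + (norm ((u_of (z (j + 1)) - u_of (z j)) /\<^sub>R h - u_of (v t)))\<^sup>2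
         + (norm ((a_of (z (j + 1)) - a_of (z j)) /\<^sub>R h - a_of (v t)))\<^sup>2)"

definition du0 :: "real \<Rightarrow> (nat \<Rightarrow> ('n::finite, 'd::finite) state) \<Rightarrow> real" where
  "du0 h z = norm ((u_of (z 1) - u_of (z 0)) /\<^sub>R h)"

definition ddu :: "real \<Rightarrow> nat \<Rightarrow> (nat \<Rightarrow> ('n::finite, 'd::finite) state) \<Rightarrow> real" where
  "ddu h k z =
     (\<Sum>j<k - 1. norm ((u_of (z (j + 2)) - 2 *\<^sub>R u_of (z (j + 1)) + u_of (z j)) /\<^sub>R h))"

definition J_disc ::
    "('n::finite, 'd::finite) sweeping \<Rightarrow> (real \<Rightarrow> ('n, 'd) state) \<Rightarrow> real \<Rightarrow> nat
      \<Rightarrow> (nat \<Rightarrow> ('n, 'd) state) \<Rightarrow> ereal" where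
  "J_disc P zbar mt k z =
     (let T = horizon P; h = mesh_step T k in
      term_cost P (x_of (z k))
      + ereal h * (\<Sum>j<k. run_cost P (mesh T k j) (z j) ((z (j + 1) - z j) /\<^sub>R h))
      + ereal (S_disc P zbar k z)
      + ereal ((infdist (du0 h z) {..mt})\<^sup>2)
      + ereal ((infdist (ddu h k z) {..mt})\<^sup>2))"

definition feasible_disc ::
    "('n::finite, 'd::finite) sweeping \<Rightarrow> (real \<Rightarrow> ('n, 'd) state) \<Rightarrow> real \<Rightarrow> real \<Rightarrow> real \<Rightarrow> nat
      \<Rightarrow> (nat \<Rightarrow> ('n, 'd) state) \<Rightarrow> bool" where
  "feasible_disc P zbar \<epsilon> mt ek k z \<longleftrightarrow>
     (let T = horizon P; h = mesh_step T k in
      (\<forall>j<k. x_of (z (j + 1)) \<in> (\<lambda>w. x_of (z j) - h *\<^sub>R w) ` F_map P (z j))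
      \<and> z 0 = (x_init P, u_of (zbar 0), a_of (zbar 0))
      \<and> (\<forall>i\<in>{1..ncon P}. con P i (x_of (z k) - u_of (z k)) \<ge> 0)
      \<and> (\<forall>j\<le>k. r_min P - ek \<le> norm (u_of (z j)) \<and> norm (u_of (z j)) \<le> r_max P + ek)
      \<and> (\<forall>j<k. norm (z j - zbar (mesh T k j)) \<le> \<epsilon> / 2)
      \<and> S_disc P zbar k z \<le> \<epsilon> / 2
      \<and> du0 h z \<le> mt + 1
      \<and> ddu h k z \<le> mt + 1)"

definition optimal_disc ::
    "('n::finite, 'd::finite) sweeping \<Rightarrow> (real \<Rightarrow> ('n, 'd) state) \<Rightarrow> real \<Rightarrow> real \<Rightarrow> real \<Rightarrow> nat
      \<Rightarrow> (nat \<Rightarrow> ('n, 'd) state) \<Rightarrow> bool" where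
  "optimal_disc P zbar \<epsilon> mt ek k z \<longleftrightarrow> feasible_disc P zbar \<epsilon> mt ek k z
     \<and> (\<forall>w. feasible_disc P zbar \<epsilon> mt ek k w \<longrightarrow> J_disc P zbar mt k z \<le> J_disc P zbar mt k w)"

end

(* The feasible set of (P_k) is nonempty for large k, because the nodes of the approximating
   trajectories z^k belong to it: W^{1,2} convergence controls both S_k and, by the AM-GM inequality
   under the integral, the distance to zbar at the nodes, while the variation of the derivative of u^k,
   sampled at the midpoints of the mesh cells, bounds the sum of the second differences.
   It is compact: the limiting normal cone has closed graph by a diagonal argument, S_k is a
   quadratic polynomial in the nodes, and all nodes but the last are kept near zbar explicitly; the last
   one is bounded through the constraint on S_k. The cost is lower semicontinuous and never takes the
   value -infinity, so it attains its minimum. *)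

theory Submission
  imports Defs
begin

section \<open>Lower semicontinuity\<close>

text \<open>Trades the \<open>Liminf\<close> for eventual strict lower bounds, the form in which
  sums, compositions and compactness are handled below.\<close>

lemma lsc_iff: "lsc h \<longleftrightarrow> (\<forall>x. \<forall>c<h x. \<forall>\<^sub>F y in nhds x. c < h y)"
  by (simp add: lsc_def le_Liminf_iff)

lemma lsc_compose:
  assumes "lsc h" "continuous_on UNIV g"
  shows "lsc (\<lambda>x. h (g x))"
  unfolding lsc_iff
proof safe
  fix x c assume "c < h (g x)"
  then have ev: "\<forall>\<^sub>F y in nhds (g x). c < h y"
    using assms(1) by (simp add: lsc_iff)
  have "filterlim g (nhds (g x)) (nhds x)"
    using assms(2) by (simp add: tendsto_at_iff_tendsto_nhds[symmetric] continuous_on_def)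
  then show "\<forall>\<^sub>F y in nhds x. c < h (g y)"
    using ev by (rule eventually_compose_filterlim[rotated])
qed

lemma lsc_ereal:
  assumes "continuous_on UNIV f"
  shows "lsc (\<lambda>x. ereal (f x))"
proof -
  have "lsc ereal"
    unfolding lsc_iff
  proof safe
    fix x c assume "c < ereal x"
    then show "\<forall>\<^sub>F y in nhds x. c < ereal y"
      by (rule order_tendstoD(1)[OF tendsto_ereal[OF filterlim_ident]])
  qed
  then show ?thesis
    using assms by (rule lsc_compose)
qed

text \<open>On \<open>ereal\<close>, adding opposite infinities gives plus infinity, so a sum could
  exceed the limit of nearby finite values; excluding minus infinity for both summands removes this
  case.\<close>

lemma lsc_add:
  assumes "lsc f" "lsc g" and f: "\<And>x. f x \<noteq> - \<infinity>" and g: "\<And>x. g x \<noteq> - \<infinity>"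
  shows "lsc (\<lambda>x. f x + g x)"
  unfolding lsc_iff
proof safe
  fix x c assume c: "c < f x + g x"
  show "\<forall>\<^sub>F y in nhds x. c < f y + g y"
  proof (cases c)
    case MInf
    then show ?thesis using f g by (auto intro!: always_eventually)
  next
    case PInf
    then show ?thesis using c by simp
  next
    case (real r)
    \<comment> \<open>The bound c = r is split into r - b for f and b for g. If f x is infinite, c -
      f x is minus infinity, so one real b serves finite and infinite values alike.\<close>
    have "c - f x < g x"
      using c f[of x] g[of x] real by (cases "f x"; cases "g x") auto
    then obtain b where b: "c - f x < ereal b" "ereal b < g x"
      using ereal_dense2 by blast
    then have "ereal (r - b) < f x"
      using f[of x] real by (cases "f x") auto
    then have "\<forall>\<^sub>F y in nhds x. ereal (r - b) < f y" "\<forall>\<^sub>F y in nhds x. ereal b < g y"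
      using assms(1,2) b by (auto simp: lsc_iff)
    then show ?thesis
    proof eventually_elim
      case (elim y)
      then show ?case
        using f[of y] g[of y] real by (cases "f y"; cases "g y") auto
    qed
  qed
qed

lemma ereal_sum_not_MInf: "(\<And>i. i \<in> I \<Longrightarrow> f i \<noteq> - \<infinity>) \<Longrightarrow> sum f I \<noteq> (- \<infinity> :: ereal)"
  by (induction I rule: infinite_finite_induct) auto

lemma lsc_sum:
  assumes "\<And>i. i \<in> I \<Longrightarrow> lsc (f i)" "\<And>i x. i \<in> I \<Longrightarrow> f i x \<noteq> - \<infinity>"
  shows "lsc (\<lambda>x. \<Sum>i\<in>I. f i x)"
  using assms
proof (induction I rule: infinite_finite_induct)
  case (insert i I)
  then show ?case
    by (auto intro!: lsc_add ereal_sum_not_MInf)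
qed (use lsc_ereal[of "\<lambda>_. 0"] in \<open>simp_all add: zero_ereal_def\<close>)

lemma lsc_cmult: "lsc f \<Longrightarrow> 0 \<le> c \<Longrightarrow> lsc (\<lambda>x. ereal c * f x)"
  by (auto simp: lsc_def Liminf_ereal_mult_left intro: ereal_mult_left_mono)

text \<open>Without a minimizer the open sets where h exceeds some value h y cover S. In a finite
  subcover, the y with the least value is a point of S that none of the chosen sets
  contains.\<close>

lemma lsc_attains_inf:
  fixes h :: "'a::topological_space \<Rightarrow> ereal"
  assumes "compact S" "S \<noteq> {}" "lsc h"
  shows "\<exists>x\<in>S. \<forall>y\<in>S. h x \<le> h y"
proof (rule ccontr)
  assume "\<not> ?thesis"
  then have cover: "S \<subseteq> (\<Union>y\<in>S. {x. h y < h x})"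
    by (auto simp: not_le)
  moreover have "open {x. c < h x}" for c
  proof (rule Topological_Spaces.openI)
    fix x assume "x \<in> {x. c < h x}"
    then have "\<forall>\<^sub>F y in nhds x. c < h y"
      using assms(3) by (simp add: lsc_iff)
    then show "\<exists>U. open U \<and> x \<in> U \<and> U \<subseteq> {x. c < h x}"
      by (auto simp: eventually_nhds)
  qed
  ultimately obtain Y where Y: "Y \<subseteq> S" "finite Y" "S \<subseteq> (\<Union>y\<in>Y. {x. h y < h x})"
    using compactE_image[OF assms(1), of S "\<lambda>y. {x. h y < h x}"] by metis
  then have "Y \<noteq> {}"
    using assms(2) by auto
  then obtain y where y: "y \<in> Y" "h y = Min (h ` Y)"
    using Min_in[of "h ` Y"] Y(2) by (metis (no_types) finite_imageI image_is_empty imageE)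
  then obtain w where "w \<in> Y" "h w < h y"
    using Y by blast
  then show False
    using y(2) Y(2) by (auto simp: not_le[symmetric])
qed

section \<open>The normal cone\<close>

text \<open>Replaces the three sequences of the definition by approximation up to an arbitrary
  \<delta>, so that the diagonal argument for closedness becomes a triangle inequality. Conversely,
  the choices for \<delta> = 1/(k+1) form the required sequences.\<close>

lemma normal_cone_iff:
  "v \<in> normal_cone \<Omega> x \<longleftrightarrow> x \<in> \<Omega> \<and>
     (\<forall>\<delta>>0. \<exists>y w \<alpha>. dist y x < \<delta> \<and> w \<in> projector \<Omega> y \<and> 0 \<le> \<alpha> \<and> dist (\<alpha> *\<^sub>R (y - w)) v < \<delta>)"
    (is "_ \<longleftrightarrow> _ \<and> (\<forall>\<delta>>0. ?P \<delta>)")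
proof (intro iffI conjI allI impI)
  assume v: "v \<in> normal_cone \<Omega> x"
  then show x: "x \<in> \<Omega>"
    by (auto simp: normal_cone_def split: if_splits)
  fix \<delta> :: real assume \<delta>: "0 < \<delta>"
  obtain xs ws \<alpha> where *: "xs \<longlonglongrightarrow> x" "\<forall>k. ws k \<in> projector \<Omega> (xs k)" "\<forall>k. \<alpha> k \<ge> (0::real)"
    "(\<lambda>k. \<alpha> k *\<^sub>R (xs k - ws k)) \<longlonglongrightarrow> v"
    using v x by (auto simp: normal_cone_def)
  have "\<forall>\<^sub>F k in sequentially. dist (xs k) x < \<delta> \<and> dist (\<alpha> k *\<^sub>R (xs k - ws k)) v < \<delta>"
    using tendstoD[OF *(1) \<delta>] tendstoD[OF *(4) \<delta>] by eventually_elim simp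
  then obtain k where "dist (xs k) x < \<delta>" "dist (\<alpha> k *\<^sub>R (xs k - ws k)) v < \<delta>"
    by (auto simp: eventually_sequentially)
  then show "?P \<delta>" using *(2,3) by blast
next
  assume R: "x \<in> \<Omega> \<and> (\<forall>\<delta>>0. ?P \<delta>)"
  have "\<exists>y w \<alpha>. dist y x < inverse (real (Suc k)) \<and> w \<in> projector \<Omega> y \<and> 0 \<le> \<alpha>
      \<and> dist (\<alpha> *\<^sub>R (y - w)) v < inverse (real (Suc k))" for k
    using R by simp
  then obtain y w \<alpha> where *: "\<And>k. dist (y k) x < inverse (real (Suc k))"
    "\<And>k. w k \<in> projector \<Omega> (y k)" "\<And>k. 0 \<le> \<alpha> k"
    "\<And>k. dist (\<alpha> k *\<^sub>R (y k - w k)) v < inverse (real (Suc k))"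
    by metis
  have lim: "X \<longlonglongrightarrow> L" if "\<And>k. dist (X k) L < inverse (real (Suc k))" for X and L :: 'a
  proof (rule metric_LIMSEQ_I)
    fix r :: real assume "0 < r"
    then obtain N where N: "inverse (real (Suc N)) < r"
      using reals_Archimedean by blast
    have "dist (X k) L < r" if "N \<le> k" for k
    proof -
      have "inverse (real (Suc k)) \<le> inverse (real (Suc N))"
        using that by (intro le_imp_inverse_le) auto
      then show ?thesis
        using N \<open>\<And>k. dist (X k) L < inverse (real (Suc k))\<close>[of k] by linarith
    qed
    then show "\<exists>N. \<forall>k\<ge>N. dist (X k) L < r" by blast
  qed
  show "v \<in> normal_cone \<Omega> x"
  proof -
    have "y \<longlonglongrightarrow> x" "(\<lambda>k. \<alpha> k *\<^sub>R (y k - w k)) \<longlonglongrightarrow> v"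
      using *(1,4) by (auto intro!: lim)
    moreover have "\<forall>k. w k \<in> projector \<Omega> (y k)" "\<forall>k. 0 \<le> \<alpha> k"
      using *(2,3) by blast+
    ultimately have "\<exists>xs ws \<alpha>. xs \<longlonglongrightarrow> x \<and> (\<forall>k. ws k \<in> projector \<Omega> (xs k)) \<and> (\<forall>k. \<alpha> k \<ge> (0::real))
        \<and> (\<lambda>k. \<alpha> k *\<^sub>R (xs k - ws k)) \<longlonglongrightarrow> v"
      by (intro exI conjI)
    then show ?thesis
      using R by (simp add: normal_cone_def)
  qed
qed

text \<open>Half of \<delta> is spent on going from the limit to a late member of the sequence, the
  other half on approximating that member. Closedness of \<Omega> keeps the limit point in \<Omega>,
  outside of which the cone is empty.\<close>

lemma closed_normal_cone_graph:
  assumes "closed \<Omega>"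
  shows "closed {(x, v). v \<in> normal_cone \<Omega> x}"
  unfolding closed_sequential_limits
proof safe
  fix s x v
  assume s: "\<forall>n. s n \<in> {(x, v). v \<in> normal_cone \<Omega> x}" "s \<longlonglongrightarrow> (x, v)"
  have x: "(\<lambda>n. fst (s n)) \<longlonglongrightarrow> x" and v: "(\<lambda>n. snd (s n)) \<longlonglongrightarrow> v"
    using tendsto_fst[OF s(2)] tendsto_snd[OF s(2)] by simp_all
  have nc: "snd (s n) \<in> normal_cone \<Omega> (fst (s n))" for n
    using s(1) by (simp add: case_prod_unfold)
  have "x \<in> \<Omega>"
    by (rule closed_sequentially[OF assms _ x]) (use nc in \<open>simp add: normal_cone_iff\<close>)
  moreover have "\<exists>y w \<alpha>. dist y x < \<delta> \<and> w \<in> projector \<Omega> y \<and> 0 \<le> \<alpha> \<and> dist (\<alpha> *\<^sub>R (y - w)) v < \<delta>"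
    if "0 < \<delta>" for \<delta>
  proof -
    have d: "0 < \<delta> / 2" using that by simp
    have "\<forall>\<^sub>F n in sequentially. dist (fst (s n)) x < \<delta> / 2 \<and> dist (snd (s n)) v < \<delta> / 2"
      using tendstoD[OF x d] tendstoD[OF v d] by eventually_elim simp
    then obtain n where n: "dist (fst (s n)) x < \<delta> / 2" "dist (snd (s n)) v < \<delta> / 2"
      by (auto simp: eventually_sequentially)
    obtain y w \<alpha> where y: "dist y (fst (s n)) < \<delta> / 2" "w \<in> projector \<Omega> y" "0 \<le> \<alpha>"
      "dist (\<alpha> *\<^sub>R (y - w)) (snd (s n)) < \<delta> / 2"
      using nc[of n] d unfolding normal_cone_iff by blast
    have "dist y x < \<delta>" "dist (\<alpha> *\<^sub>R (y - w)) v < \<delta>"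
      using y(1,4) n dist_triangle[of y x "fst (s n)"]
        dist_triangle[of "\<alpha> *\<^sub>R (y - w)" v "snd (s n)"] by linarith+
    with y(2,3) show ?thesis by blast
  qed
  ultimately show "v \<in> normal_cone \<Omega> x"
    by (simp add: normal_cone_iff)
qed

section \<open>Velocities along the mesh\<close>

lemma mesh_0 [simp]: "mesh T k 0 = 0"
  by (simp add: mesh_def)

lemma mesh_last: "0 < k \<Longrightarrow> mesh T k k = T"
  by (simp add: mesh_def mesh_step_def)

lemma mesh_Suc: "mesh T k (Suc j) = mesh T k j + mesh_step T k"
  by (simp add: mesh_def algebra_simps)

lemma mesh_step_pos: "0 < T \<Longrightarrow> 0 < k \<Longrightarrow> 0 < mesh_step T k"
  by (simp add: mesh_step_def)

lemma mesh_mono: "0 \<le> T \<Longrightarrow> i \<le> j \<Longrightarrow> mesh T k i \<le> mesh T k j"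
  by (simp add: mesh_def mesh_step_def mult_right_mono divide_right_mono)

lemma mesh_in_interval: "0 \<le> T \<Longrightarrow> 0 < k \<Longrightarrow> j \<le> k \<Longrightarrow> mesh T k j \<in> {0..T}"
  using mesh_mono[of T 0 j k] mesh_mono[of T j k k] by (simp add: mesh_last)

lemma mesh_cell_subset:
  "0 \<le> T \<Longrightarrow> 0 < k \<Longrightarrow> j < k \<Longrightarrow> {mesh T k j..mesh T k (Suc j)} \<subseteq> {0..T}"
  using mesh_in_interval[of T k j] mesh_in_interval[of T k "Suc j"] by auto

lemma has_integral_mesh:
  fixes f :: "real \<Rightarrow> 'a::banach"
  assumes "0 \<le> T" "\<And>j. j < n \<Longrightarrow> (f has_integral I j) {mesh T k j..mesh T k (Suc j)}"
  shows "(f has_integral (\<Sum>j<n. I j)) {0..mesh T k n}"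
  using assms(2)
proof (induction n)
  case 0
  then show ?case using has_integral_refl(2)[of f 0] by simp
next
  case (Suc n)
  show ?case
    using has_integral_combine[of 0 "mesh T k n" "mesh T k (Suc n)" f] Suc
      mesh_mono[OF assms(1), of 0 n k] mesh_mono[OF assms(1), of n "Suc n" k] by simp
qed

section \<open>Derivatives of functions in W^{1,2}\<close>

lemma time_deriv_eq:
  fixes z :: "real \<Rightarrow> 'a::euclidean_space"
  assumes "0 < T" "t \<in> {0..T}" "(z has_vector_derivative v) (at t within {0..T})"
  shows "time_deriv T z t = v"
  unfolding time_deriv_def using assms by (intro vector_derivative_within_closed_interval)

lemma LINT_eq_integral:
  fixes f :: "real \<Rightarrow> 'a::euclidean_space"
  assumes "f absolutely_integrable_on {a..b}"
  shows "(LINT t|lebesgue_on {a..b}. f t) = integral {a..b} f"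
  using assms by (intro lebesgue_integral_eq_integral absolutely_integrable_imp_integrable) auto

lemma integrable_imp_absolutely_integrable:
  fixes f :: "real \<Rightarrow> 'a::euclidean_space"
  assumes "integrable (lebesgue_on {a..b}) f"
  shows "f absolutely_integrable_on {a..b}"
  using assms by (simp add: integrable_restrict_space set_integrable_def)

text \<open>The square integrable witness v of \<open>W12\<close> equals
  \<open>time_deriv T z\<close> off a null set, so integrability and the fundamental theorem pass
  from v to the concrete derivative.\<close>

lemma W12_time_deriv:
  fixes z :: "real \<Rightarrow> 'a::euclidean_space"
  assumes T: "0 < T" and z: "W12 T z"
  shows "time_deriv T z absolutely_integrable_on {0..T}"
    and "(\<lambda>t. (norm (time_deriv T z t))\<^sup>2) integrable_on {0..T}"
    and "\<lbrakk>0 \<le> s; s \<le> t; t \<le> T\<rbrakk> \<Longrightarrow> (time_deriv T z has_integral z t - z s) {s..t}"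
proof -
  let ?V = "time_deriv T z"
  obtain v where v: "v \<in> borel_measurable (lebesgue_on {0..T})"
    "integrable (lebesgue_on {0..T}) (\<lambda>t. (norm (v t))\<^sup>2)"
    "AE t in lebesgue_on {0..T}. (z has_vector_derivative v t) (at t within {0..T})"
    "\<And>t. t \<in> {0..T} \<Longrightarrow> z t = z 0 + (LINT s|lebesgue_on {0..t}. v s)"
    using z unfolding W12_def by blast
  let ?N = "{t. \<not> (t \<in> {0..T} \<longrightarrow> ?V t = v t)}"
  have "AE t in lebesgue_on {0..T}. ?V t = v t"
    using v(3) AE_space by eventually_elim (simp add: time_deriv_eq[OF T])
  then have "AE t in lebesgue. t \<in> {0..T} \<longrightarrow> ?V t = v t"
    by (simp add: AE_restrict_space_iff)
  then have neg: "negligible ?N"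
    \<comment> \<open>The exceptional set only lies inside a measurable null set; completeness of
      Lebesgue measure makes it null itself.\<close>
    unfolding eventually_ae_filter using negligible_subset
    by (auto simp: negligible_iff_null_sets intro: completion.complete2)
  interpret finite_measure "lebesgue_on {0..T}"
    by (rule finite_measure_lebesgue_on) auto
  have "integrable (lebesgue_on {0..T}) v"
  proof (rule Bochner_Integration.integrable_bound)
    show "integrable (lebesgue_on {0..T}) (\<lambda>t. 1 + (norm (v t))\<^sup>2)"
      using v(2) by (intro Bochner_Integration.integrable_add) auto
    \<comment> \<open>On an interval of finite measure this pointwise bound makes square integrable
      functions integrable; it follows from (|x| - 1/2)^2 >= 0.\<close>
    have "norm x \<le> 1 + (norm x)\<^sup>2" for x :: 'a
      using zero_le_power2[of "norm x - 1/2"] by (simp add: power2_eq_square algebra_simps)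
    then show "AE t in lebesgue_on {0..T}. norm (v t) \<le> norm (1 + (norm (v t))\<^sup>2)"
      by (auto intro!: always_eventually)
  qed (use v in auto)
  then have vi: "v absolutely_integrable_on {0..T}"
    by (rule integrable_imp_absolutely_integrable)
  show Vi: "?V absolutely_integrable_on {0..T}"
    using absolutely_integrable_spike[OF vi neg, of ?V] by auto
  have "(\<lambda>t. (norm (v t))\<^sup>2) integrable_on {0..T}"
    using integrable_imp_absolutely_integrable[OF v(2)] by (simp add: absolutely_integrable_on_def)
  then show "(\<lambda>t. (norm (?V t))\<^sup>2) integrable_on {0..T}"
    by (rule integrable_spike[OF _ neg]) auto
  have z: "z t = z 0 + integral {0..t} ?V" if "0 \<le> t" "t \<le> T" for t
  proof -
    have "v absolutely_integrable_on {0..t}"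
      using vi that by (intro absolutely_integrable_on_subinterval[OF vi]) auto
    then have "z t = z 0 + integral {0..t} v"
      using v(4)[of t] that by (simp add: LINT_eq_integral)
    also have "integral {0..t} v = integral {0..t} ?V"
      by (rule integral_spike[OF neg]) (use that in auto)
    finally show ?thesis .
  qed
  assume st: "0 \<le> s" "s \<le> t" "t \<le> T"
  have int: "?V integrable_on {a..b}" if "0 \<le> a" "b \<le> T" for a b
    using absolutely_integrable_on_subinterval[OF Vi, of a b] that
    by (auto simp: absolutely_integrable_on_def)
  have "integral {0..s} ?V + integral {s..t} ?V = integral {0..t} ?V"
    by (rule Henstock_Kurzweil_Integration.integral_combine) (use st int in auto)
  then have "integral {s..t} ?V = z t - z s"
    using z[of s] z[of t] st by (simp add: algebra_simps)
  then show "(?V has_integral z t - z s) {s..t}"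
    using int[of s t] st integrable_integral by fastforce
qed

section \<open>Squared velocity errors on the mesh cells\<close>

lemma has_integral_sq_dist:
  fixes V :: "real \<Rightarrow> 'a::euclidean_space"
  assumes "a \<le> b" "(V has_integral A) {a..b}" "((\<lambda>t. (norm (V t))\<^sup>2) has_integral B) {a..b}"
  shows "((\<lambda>t. (norm (c - V t))\<^sup>2) has_integral (b - a) * (norm c)\<^sup>2 - 2 * (c \<bullet> A) + B) {a..b}"
proof -
  have "((\<lambda>t. c \<bullet> V t) has_integral c \<bullet> A) {a..b}"
    using has_integral_linear[OF assms(2) bounded_linear_inner_right[of c]] by (simp add: o_def)
  then have "((\<lambda>t. (norm c)\<^sup>2 - 2 * (c \<bullet> V t) + (norm (V t))\<^sup>2) has_integral
      (b - a) * (norm c)\<^sup>2 - 2 * (c \<bullet> A) + B) {a..b}"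
    using has_integral_const_real[of "(norm c)\<^sup>2" a b] assms(1)
    by (intro has_integral_add has_integral_diff has_integral_mult_right assms(3)) auto
  moreover have "(norm (c - V t))\<^sup>2 = (norm c)\<^sup>2 - 2 * (c \<bullet> V t) + (norm (V t))\<^sup>2" for t
    by (simp add: power2_norm_eq_inner inner_diff inner_commute)
  ultimately show ?thesis by simp
qed

lemma norm_state_sq: "(norm (z :: ('n::finite, 'd::finite) state))\<^sup>2
    = (norm (x_of z))\<^sup>2 + (norm (u_of z))\<^sup>2 + (norm (a_of z))\<^sup>2"
  by (simp add: norm_prod_def)

lemma piecewise_linear_deriv:
  fixes z :: "real \<Rightarrow> 'a::euclidean_space"
  assumes "piecewise_linear T k z" "j < k" "mesh T k j < t" "t < mesh T k (Suc j)"
  shows "(z has_vector_derivative (z (mesh T k (Suc j)) - z (mesh T k j)) /\<^sub>R mesh_step T k) (at t)"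
proof (rule has_vector_derivative_transform_within_open)
  let ?c = "z (mesh T k (Suc j)) - z (mesh T k j)"
  show "((\<lambda>s. z (mesh T k j) + ((s - mesh T k j) / mesh_step T k) *\<^sub>R ?c)
      has_vector_derivative ?c /\<^sub>R mesh_step T k) (at t)"
    by (auto intro!: derivative_eq_intros simp: divide_inverse)
  show "t \<in> {mesh T k j<..<mesh T k (Suc j)}" using assms by simp
  show "open {mesh T k j<..<mesh T k (Suc j)}" by simp
  show "z (mesh T k j) + ((s - mesh T k j) / mesh_step T k) *\<^sub>R ?c = z s"
    if "s \<in> {mesh T k j<..<mesh T k (Suc j)}" for s
  proof -
    have "s \<in> {mesh T k j..mesh T k (Suc j)}"
      using that by simp
    with assms(1,2) show ?thesis
      unfolding piecewise_linear_def by metis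
  qed
qed

lemma piecewise_linear_time_deriv:
  fixes z :: "real \<Rightarrow> 'a::euclidean_space"
  assumes "0 < T" "piecewise_linear T k z" "j < k" "mesh T k j < t" "t < mesh T k (Suc j)"
  shows "time_deriv T z t = (z (mesh T k (Suc j)) - z (mesh T k j)) /\<^sub>R mesh_step T k"
    and "z differentiable (at t within {0..T})"
proof -
  have t: "t \<in> {0..T}"
    using mesh_cell_subset[of T k j] assms by force
  note d = has_vector_derivative_at_within[OF piecewise_linear_deriv[OF assms(2-)], of "{0..T}"]
  show "time_deriv T z t = (z (mesh T k (Suc j)) - z (mesh T k j)) /\<^sub>R mesh_step T k"
    by (rule time_deriv_eq[OF assms(1) t d])
  show "z differentiable (at t within {0..T})"
    using d by (auto simp: has_vector_derivative_def differentiable_def)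
qed

text \<open>The j-th summand of S_k when V is the velocity of the reference trajectory. As the norm
  of a state is Euclidean, one squared norm covers the three components.\<close>

definition velocity_error :: "real \<Rightarrow> nat \<Rightarrow> (nat \<Rightarrow> 'a::euclidean_space) \<Rightarrow> (real \<Rightarrow> 'a) \<Rightarrow> nat \<Rightarrow> real" where
  "velocity_error T k z V j = integral {mesh T k j..mesh T k (Suc j)}
     (\<lambda>t. (norm ((z (Suc j) - z j) /\<^sub>R mesh_step T k - V t))\<^sup>2)"

lemma W12_cell:
  fixes zbar :: "real \<Rightarrow> 'a::euclidean_space"
  assumes "0 < T" "W12 T zbar" "j < k"
  defines "S \<equiv> {mesh T k j..mesh T k (Suc j)}"
  shows "(time_deriv T zbar has_integral zbar (mesh T k (Suc j)) - zbar (mesh T k j)) S"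
    and "((\<lambda>t. (norm (time_deriv T zbar t))\<^sup>2) has_integral
            integral S (\<lambda>t. (norm (time_deriv T zbar t))\<^sup>2)) S"
proof -
  have sub: "S \<subseteq> {0..T}"
    unfolding S_def using assms by (intro mesh_cell_subset) auto
  show "(time_deriv T zbar has_integral zbar (mesh T k (Suc j)) - zbar (mesh T k j)) S"
    unfolding S_def using assms mesh_in_interval[of T k j] mesh_in_interval[of T k "Suc j"]
      mesh_mono[of T j "Suc j" k]
    by (intro W12_time_deriv(3)) auto
  show "((\<lambda>t. (norm (time_deriv T zbar t))\<^sup>2) has_integral
            integral S (\<lambda>t. (norm (time_deriv T zbar t))\<^sup>2)) S"
    using integrable_subinterval_real[OF W12_time_deriv(2)[OF assms(1,2)] sub[unfolded S_def]]
    unfolding S_def by (rule integrable_integral)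
qed

lemma velocity_error_has_integral:
  fixes zbar :: "real \<Rightarrow> 'a::euclidean_space"
  assumes "0 < T" "W12 T zbar" "j < k"
  shows "((\<lambda>t. (norm (c - time_deriv T zbar t))\<^sup>2) has_integral
     mesh_step T k * (norm c)\<^sup>2 - 2 * (c \<bullet> (zbar (mesh T k (Suc j)) - zbar (mesh T k j)))
      + integral {mesh T k j..mesh T k (Suc j)} (\<lambda>t. (norm (time_deriv T zbar t))\<^sup>2))
      {mesh T k j..mesh T k (Suc j)}"
proof -
  have le: "mesh T k j \<le> mesh T k (Suc j)"
    using assms(1) by (intro mesh_mono) auto
  have h: "mesh T k (Suc j) - mesh T k j = mesh_step T k"
    by (simp add: mesh_Suc)
  show ?thesis
    using has_integral_sq_dist[OF le W12_cell[OF assms], of c] unfolding h .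
qed

text \<open>Expanding the square leaves a quadratic polynomial in two neighbouring nodes whose
  coefficients do not depend on the process; continuity of \<open>S_disc\<close> is read off from
  it.\<close>

lemma velocity_error_eq:
  fixes zbar :: "real \<Rightarrow> 'a::euclidean_space"
  assumes "0 < T" "W12 T zbar" "j < k"
  shows "velocity_error T k z (time_deriv T zbar) j =
     mesh_step T k * (norm ((z (Suc j) - z j) /\<^sub>R mesh_step T k))\<^sup>2
      - 2 * (((z (Suc j) - z j) /\<^sub>R mesh_step T k) \<bullet> (zbar (mesh T k (Suc j)) - zbar (mesh T k j)))
      + integral {mesh T k j..mesh T k (Suc j)} (\<lambda>t. (norm (time_deriv T zbar t))\<^sup>2)"
  unfolding velocity_error_def by (rule integral_unique[OF velocity_error_has_integral[OF assms]])

lemma has_integral_velocity_error: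
  fixes zbar :: "real \<Rightarrow> 'a::euclidean_space"
  assumes "0 < T" "W12 T zbar" "j < k"
  shows "((\<lambda>t. (norm ((z (Suc j) - z j) /\<^sub>R mesh_step T k - time_deriv T zbar t))\<^sup>2) has_integral
     velocity_error T k z (time_deriv T zbar) j) {mesh T k j..mesh T k (Suc j)}"
  unfolding velocity_error_eq[OF assms] by (rule velocity_error_has_integral[OF assms])

lemma S_disc_eq:
  assumes "0 < horizon P" "W12 (horizon P) zbar"
  shows "S_disc P zbar k z
    = (\<Sum>j<k. velocity_error (horizon P) k z (time_deriv (horizon P) zbar) j)"
  unfolding S_disc_def Let_def
proof (rule sum.cong[OF refl])
  fix j assume "j \<in> {..<k}"
  then have j: "j < k" by simp
  let ?S = "{mesh (horizon P) k j..mesh (horizon P) k (Suc j)}"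
  let ?h = "mesh_step (horizon P) k"
  let ?f = "\<lambda>t. (norm ((z (Suc j) - z j) /\<^sub>R ?h - time_deriv (horizon P) zbar t))\<^sup>2"
  \<comment> \<open>\<open>S_disc\<close> uses Lebesgue integrals and \<open>velocity_error\<close>
    gauge integrals; nonnegativity of the integrand lets integrability pass from the latter to the
    former.\<close>
  have "?f absolutely_integrable_on ?S"
    using has_integral_integrable[OF has_integral_velocity_error[OF assms j]]
    by (intro nonnegative_absolutely_integrable_1) auto
  then have "(LINT t|lebesgue_on ?S. ?f t) = velocity_error (horizon P) k z (time_deriv (horizon P) zbar) j"
    by (simp add: LINT_eq_integral velocity_error_def)
  then show "(LINT t|lebesgue_on {mesh (horizon P) k j..mesh (horizon P) k (j + 1)}.
          (norm ((x_of (z (j + 1)) - x_of (z j)) /\<^sub>R ?h - x_of (time_deriv (horizon P) zbar t)))\<^sup>2 +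
          (norm ((u_of (z (j + 1)) - u_of (z j)) /\<^sub>R ?h - u_of (time_deriv (horizon P) zbar t)))\<^sup>2 +
          (norm ((a_of (z (j + 1)) - a_of (z j)) /\<^sub>R ?h - a_of (time_deriv (horizon P) zbar t)))\<^sup>2) =
         velocity_error (horizon P) k z (time_deriv (horizon P) zbar) j"
    by (simp add: norm_state_sq)
qed

text \<open>Holds for arbitrary V because the integral of a non-integrable function is 0 by
  convention.\<close>

lemma velocity_error_nonneg: "0 \<le> velocity_error T k z V j"
  unfolding velocity_error_def
  by (metis (no_types, lifting) Henstock_Kurzweil_Integration.integral_nonneg
      not_integrable_integral order_refl zero_le_power2)

text \<open>The derivative of a piecewise linear z inside a cell is its difference quotient, so the
  sum equals the derivative part of the squared distance; the remaining part is nonnegative.\<close>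

lemma sum_velocity_error_le_W12_dist_sq:
  fixes z zbar :: "real \<Rightarrow> 'a::euclidean_space"
  assumes "0 < T" "W12 T zbar" "0 < k" "piecewise_linear T k z"
  shows "(\<Sum>j<k. velocity_error T k (\<lambda>j. z (mesh T k j)) (time_deriv T zbar) j) \<le> W12_dist_sq T z zbar"
proof -
  let ?f = "\<lambda>t. (norm (time_deriv T z t - time_deriv T zbar t))\<^sup>2"
  let ?v = "velocity_error T k (\<lambda>j. z (mesh T k j)) (time_deriv T zbar)"
  have "(?f has_integral ?v j) {mesh T k j..mesh T k (Suc j)}" if j: "j < k" for j
  \<comment> \<open>At the two ends of a cell the slope may jump, so these points are
    exempted.\<close>
  proof (rule has_integral_spike_finite)
    show "((\<lambda>t. (norm ((z (mesh T k (Suc j)) - z (mesh T k j)) /\<^sub>R mesh_step T k - time_deriv T zbar t))\<^sup>2)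
      has_integral ?v j) {mesh T k j..mesh T k (Suc j)}"
      by (rule has_integral_velocity_error[OF assms(1,2) j])
    show "finite {mesh T k j, mesh T k (Suc j)}" by simp
  qed (use piecewise_linear_time_deriv(1)[OF assms(1,4) j] in auto)
  then have "(?f has_integral (\<Sum>j<k. ?v j)) {0..mesh T k k}"
    using assms(1) by (intro has_integral_mesh) auto
  then have f: "(?f has_integral (\<Sum>j<k. ?v j)) {0..T}"
    using mesh_last[of k T] assms(3) by simp
  then have "?f absolutely_integrable_on {0..T}"
    by (intro nonnegative_absolutely_integrable_1) (auto simp: integrable_on_def)
  then have "(LINT t|lebesgue_on {0..T}. ?f t) = (\<Sum>j<k. ?v j)"
    using f by (simp add: LINT_eq_integral integral_unique)
  moreover have "0 \<le> (LINT t|lebesgue_on {0..T}. (norm (z t - zbar t))\<^sup>2)"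
    by (rule Bochner_Integration.integral_nonneg) auto
  ultimately show ?thesis
    by (simp add: W12_dist_sq_def)
qed

text \<open>The deviation at a node telescopes into integrals of velocity differences over the
  cells. The bound |x| <= (\<delta> + x^2/\<delta>)/2 takes the place of Cauchy-Schwarz, and
  \<delta> stays free to be balanced later.\<close>

lemma node_dist_le:
  fixes zbar :: "real \<Rightarrow> 'a::euclidean_space"
  assumes "0 < T" "W12 T zbar" "z 0 = zbar 0" "0 < \<delta>" "j \<le> k"
  shows "norm (z j - zbar (mesh T k j))
    \<le> (\<delta> * T + (\<Sum>i<k. velocity_error T k z (time_deriv T zbar) i) / \<delta>) / 2"
proof (cases "k = 0")
  case True
  then show ?thesis using assms by simp
next
  case False
  let ?h = "mesh_step T k"
  let ?v = "velocity_error T k z (time_deriv T zbar)"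
  have h: "0 < ?h" using assms False by (simp add: mesh_step_pos)
  have step: "norm ((z (Suc i) - zbar (mesh T k (Suc i))) - (z i - zbar (mesh T k i)))
      \<le> (\<delta> * ?h + ?v i / \<delta>) / 2" if i: "i < k" for i
  proof -
    define c where "c = (z (Suc i) - z i) /\<^sub>R ?h"
    let ?S = "{mesh T k i..mesh T k (Suc i)}"
    have c: "z (Suc i) - z i = ?h *\<^sub>R c"
      using h by (simp add: c_def)
    have le: "mesh T k i \<le> mesh T k (Suc i)"
      using assms(1) by (intro mesh_mono) auto
    have 1: "((\<lambda>t. c - time_deriv T zbar t) has_integral
        ?h *\<^sub>R c - (zbar (mesh T k (Suc i)) - zbar (mesh T k i))) ?S"
      using has_integral_diff[OF has_integral_const_real[of c] W12_cell(1)[OF assms(1,2) i]] le h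
      by (simp add: mesh_Suc)
    have sq: "((\<lambda>t. (norm (c - time_deriv T zbar t))\<^sup>2) has_integral ?v i) ?S"
      unfolding c_def by (rule has_integral_velocity_error[OF assms(1,2) i])
    have 2: "((\<lambda>t. (\<delta> + (norm (c - time_deriv T zbar t))\<^sup>2 / \<delta>) / 2) has_integral
        (\<delta> * ?h + ?v i / \<delta>) / 2) ?S"
    proof (intro has_integral_divide has_integral_add sq)
      show "((\<lambda>t. \<delta>) has_integral \<delta> * ?h) ?S"
        using has_integral_const_real[of \<delta> "mesh T k i" "mesh T k (Suc i)"] le
        by (simp add: mesh_Suc mult.commute)
    qed
    have amgm: "x \<le> (\<delta> + x\<^sup>2 / \<delta>) / 2" for x
    proof -
      have "2 * x * \<delta> \<le> \<delta> * \<delta> + x\<^sup>2"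
        using zero_le_power2[of "x - \<delta>"] unfolding power2_eq_square by (simp add: algebra_simps)
      then have "2 * x * \<delta> / \<delta> \<le> (\<delta> * \<delta> + x\<^sup>2) / \<delta>"
        using assms(4) by (intro divide_right_mono) auto
      then show ?thesis
        using assms(4) by (simp add: add_divide_distrib)
    qed
    have "norm (integral ?S (\<lambda>t. c - time_deriv T zbar t))
        \<le> integral ?S (\<lambda>t. (\<delta> + (norm (c - time_deriv T zbar t))\<^sup>2 / \<delta>) / 2)"
      by (rule integral_norm_bound_integral[OF has_integral_integrable[OF 1] has_integral_integrable[OF 2] amgm])
    then show ?thesis
      unfolding integral_unique[OF 1] integral_unique[OF 2] c[symmetric] by (simp only: diff_diff_eq2 algebra_simps)
  qed
  have "z j - zbar (mesh T k j) = (\<Sum>i<j. (z (Suc i) - zbar (mesh T k (Suc i))) - (z i - zbar (mesh T k i)))"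
    using sum_lessThan_telescope[of "\<lambda>i. z i - zbar (mesh T k i)" j] assms(3) by simp
  also have "norm \<dots> \<le> (\<Sum>i<j. (\<delta> * ?h + ?v i / \<delta>) / 2)"
    using assms(5) by (intro order_trans[OF norm_sum] sum_mono step) auto
  also have "\<dots> \<le> (\<Sum>i<k. (\<delta> * ?h + ?v i / \<delta>) / 2)"
    using assms(4,5) h by (intro sum_mono2) (auto intro!: add_nonneg_nonneg velocity_error_nonneg divide_nonneg_pos)
  also have "\<dots> = (\<delta> * T + (\<Sum>i<k. ?v i) / \<delta>) / 2"
    using False by (simp add: sum_divide_distrib[symmetric] sum.distrib mesh_step_def)
  finally show ?thesis .
qed

text \<open>Second differences divided by the step are the jumps of the slope between neighbouring
  cells. Sampling at cell midpoints stays within the points of differentiability over which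
  \<open>var_dot\<close> is taken.\<close>

lemma ddu_le_var_dot:
  fixes z :: "nat \<Rightarrow> ('n::finite, 'd::finite) state" and u :: "real \<Rightarrow> real^'n"
  assumes T: "0 < T" and "0 < k" "piecewise_linear T k u" and z: "\<And>j. j \<le> k \<Longrightarrow> u_of (z j) = u (mesh T k j)"
  shows "ereal (ddu (mesh_step T k) k z) \<le> var_dot T u"
proof -
  define s where "s j = mesh T k j + mesh_step T k / 2" for j
  have h: "0 < mesh_step T k" using assms by (simp add: mesh_step_pos)
  have s: "mesh T k j < s j" "s j < mesh T k (Suc j)" for j
    using h by (simp_all add: s_def mesh_Suc)
  have d: "time_deriv T u (s j) = (u (mesh T k (Suc j)) - u (mesh T k j)) /\<^sub>R mesh_step T k"
    and m: "s j \<in> {t \<in> {0..T}. u differentiable (at t within {0..T})}" if "j < k" for j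
  proof -
    show "time_deriv T u (s j) = (u (mesh T k (Suc j)) - u (mesh T k j)) /\<^sub>R mesh_step T k"
      by (rule piecewise_linear_time_deriv(1)[OF T assms(3) that s])
    have "s j \<in> {mesh T k j..mesh T k (Suc j)}"
      using s[of j] by simp
    then have "s j \<in> {0..T}"
      using mesh_cell_subset[of T k j] T that assms(2) by (meson less_imp_le subsetD)
    then show "s j \<in> {t \<in> {0..T}. u differentiable (at t within {0..T})}"
      using piecewise_linear_time_deriv(2)[OF T assms(3) that s] by simp
  qed
  have "ddu (mesh_step T k) k z = (\<Sum>j<k - 1. norm (time_deriv T u (s (Suc j)) - time_deriv T u (s j)))"
    unfolding ddu_def
  proof (intro sum.cong refl)
    fix j assume "j \<in> {..<k - 1}"
    then have j: "j < k" "Suc j < k" by auto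
    have "time_deriv T u (s j) = (u_of (z (j + 1)) - u_of (z j)) /\<^sub>R mesh_step T k"
      "time_deriv T u (s (Suc j)) = (u_of (z (j + 2)) - u_of (z (j + 1))) /\<^sub>R mesh_step T k"
      using d[OF j(1)] d[OF j(2)] z[of j] z[of "Suc j"] z[of "Suc (Suc j)"] j by simp_all
    then have "time_deriv T u (s (Suc j)) - time_deriv T u (s j)
        = (u_of (z (j + 2)) - u_of (z (j + 1)) - (u_of (z (j + 1)) - u_of (z j))) /\<^sub>R mesh_step T k"
      by (simp only: scaleR_diff_right)
    also have "u_of (z (j + 2)) - u_of (z (j + 1)) - (u_of (z (j + 1)) - u_of (z j))
        = u_of (z (j + 2)) - 2 *\<^sub>R u_of (z (j + 1)) + u_of (z j)"
      by (simp add: scaleR_2)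
    finally show "norm ((u_of (z (j + 2)) - 2 *\<^sub>R u_of (z (j + 1)) + u_of (z j)) /\<^sub>R mesh_step T k)
       = norm (time_deriv T u (s (Suc j)) - time_deriv T u (s j))"
      by simp
  qed
  \<comment> \<open>The k midpoints have indices 0 to k - 1 and give k - 1 increments, exactly the
    range of the sum in \<open>ddu\<close>.\<close>
  moreover have "(k - 1, s) \<in> {(N, s). strict_mono_on {..N} s
      \<and> s ` {..N} \<subseteq> {t \<in> {0..T}. u differentiable (at t within {0..T})}}"
  proof -
    have "strict_mono_on {..k - 1} s"
      using h by (intro strict_mono_onI) (simp add: s_def mesh_def)
    moreover have "s ` {..k - 1} \<subseteq> {t \<in> {0..T}. u differentiable (at t within {0..T})}"
      using assms(2) by (intro image_subsetI m) auto
    ultimately show ?thesis by simp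
  qed
  then have "ereal (\<Sum>i<k - 1. norm (time_deriv T u (s (Suc i)) - time_deriv T u (s i))) \<le> var_dot T u"
    unfolding var_dot_def total_variation_def by (rule SUP_upper2) simp
  ultimately show ?thesis by simp
qed

section \<open>Compactness and existence\<close>

lemma closed_C_set:
  assumes "standing P"
  shows "closed (C_set P)"
proof -
  have "continuous_on UNIV (con P i)" if "i \<in> {1..ncon P}" for i
    using assms that by (intro convex_on_continuous) (auto simp: standing_def)
  then have "closed (C_comp P i)" if "i \<in> {1..ncon P}" for i
    unfolding C_comp_def using that by (intro closed_Collect_le continuous_on_const) auto
  then show ?thesis
    unfolding C_set_def by (intro closed_INT) auto
qed

lemma continuous_on_node [continuous_intros]:
  "continuous_on UNIV (\<lambda>z :: nat \<Rightarrow> 'a::topological_space. z j)"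
  by simp

text \<open>Tychonoff's theorem. Processes are functions on all of \<open>nat\<close>, whose
  topology is the product topology.\<close>

lemma compact_coordinatewise:
  fixes B :: "nat \<Rightarrow> 'a::euclidean_space set"
  assumes "\<And>j. compact (B j)"
  shows "compact {z. \<forall>j. z j \<in> B j}"
proof -
  have "compactin (product_topology (\<lambda>_. euclidean) UNIV) (PiE UNIV B)"
    using assms by (simp add: compactin_PiE)
  moreover have "PiE UNIV B = {z. \<forall>j. z j \<in> B j}"
    by (auto simp: PiE_def Pi_def)
  ultimately show ?thesis
    by (simp add: euclidean_product_topology)
qed

text \<open>Solving the discrete inclusion for the normal vector turns it into membership in the
  graph of the normal cone, for a pair that depends continuously on the nodes under (H1).\<close>

lemma inclusion_step_iff:
  assumes "0 < h"
  shows "x' \<in> (\<lambda>w. x_of z - h *\<^sub>R w) ` F_map P z \<longleftrightarrow>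
    (x_of z - x') /\<^sub>R h - drift P (x_of z) (a_of z) \<in> normal_cone (C_set P) (x_of z - u_of z)"
    (is "?L \<longleftrightarrow> ?w \<in> ?N")
proof
  assume ?L
  then obtain v where "v \<in> ?N" "x' = x_of z - h *\<^sub>R (v + drift P (x_of z) (a_of z))"
    by (auto simp: F_map_def)
  then show "?w \<in> ?N" using assms by simp
next
  assume "?w \<in> ?N"
  then have "?w + drift P (x_of z) (a_of z) \<in> F_map P z"
    unfolding F_map_def by blast
  then have "x_of z - h *\<^sub>R (?w + drift P (x_of z) (a_of z)) \<in> (\<lambda>w. x_of z - h *\<^sub>R w) ` F_map P z"
    by blast
  then show ?L using assms by simp
qed

lemma closed_inclusion_step:
  fixes P :: "('n::finite, 'd::finite) sweeping"
  assumes "standing P" "H1 P" "0 < h"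
  shows "closed {z :: nat \<Rightarrow> ('n, 'd) state. x_of (z (j + 1)) \<in> (\<lambda>w. x_of (z j) - h *\<^sub>R w) ` F_map P (z j)}"
proof -
  let ?d = "\<lambda>z :: nat \<Rightarrow> ('n, 'd) state. (\<lambda>(x, a). drift P x a) (x_of (z j), a_of (z j))"
  let ?g = "\<lambda>z :: nat \<Rightarrow> ('n, 'd) state. (x_of (z j) - u_of (z j), (x_of (z j) - x_of (z (j + 1))) /\<^sub>R h - ?d z)"
  have d: "continuous_on UNIV ?d"
    by (rule continuous_on_compose2[where g="\<lambda>(x, a). drift P x a" and t=UNIV])
       (use assms(2) in \<open>auto simp: H1_def intro!: continuous_intros\<close>)
  have "continuous_on UNIV ?g"
    by (intro continuous_intros d)
  then have "closed (?g -` {(x, v). v \<in> normal_cone (C_set P) x})"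
    by (intro closed_vimage closed_normal_cone_graph closed_C_set assms(1))
  moreover have "?g -` {(x, v). v \<in> normal_cone (C_set P) x}
      = {z. x_of (z (j + 1)) \<in> (\<lambda>w. x_of (z j) - h *\<^sub>R w) ` F_map P (z j)}"
    unfolding inclusion_step_iff[OF assms(3)] by (simp add: vimage_def)
  ultimately show ?thesis by simp
qed

lemma continuous_on_S_disc:
  fixes P :: "('n::finite, 'd::finite) sweeping"
  assumes "0 < horizon P" "W12 (horizon P) zbar"
  shows "continuous_on UNIV (S_disc P zbar k)"
proof -
  have "continuous_on UNIV (\<lambda>z. \<Sum>j<k. velocity_error (horizon P) k z (time_deriv (horizon P) zbar) j)"
  proof (rule continuous_on_sum)
    fix j assume "j \<in> {..<k}"
    then show "continuous_on UNIV (\<lambda>z. velocity_error (horizon P) k z (time_deriv (horizon P) zbar) j)"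
      by (simp only: lessThan_iff velocity_error_eq[OF assms]) (intro continuous_intros)
  qed
  then show ?thesis
    by (simp add: S_disc_eq[OF assms, abs_def])
qed

lemma continuous_on_du0: "continuous_on UNIV (du0 h)"
  unfolding du0_def[abs_def] by (intro continuous_intros)

lemma continuous_on_ddu: "continuous_on UNIV (ddu h k)"
  unfolding ddu_def[abs_def] by (intro continuous_intros)

text \<open>The localization around zbar stops at node k - 1, so the last node is controlled only
  through the last summand of S_k.\<close>

lemma last_node_bound:
  assumes "0 < horizon P" "W12 (horizon P) zbar" "0 < k"
  shows "\<exists>r. \<forall>z. S_disc P zbar k z \<le> \<epsilon> / 2 \<longrightarrow> norm (z k - z (k - 1)) \<le> r"
proof -
  let ?T = "horizon P"
  let ?V = "time_deriv ?T zbar"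
  let ?h = "mesh_step ?T k"
  let ?S = "{mesh ?T k (k - 1)..mesh ?T k (Suc (k - 1))}"
  let ?B = "integral ?S (\<lambda>t. (norm (?V t))\<^sup>2)"
  have h: "0 < ?h" using assms by (simp add: mesh_step_pos)
  have k: "k - 1 < k" "Suc (k - 1) = k" using assms(3) by auto
  have le: "mesh ?T k (k - 1) \<le> mesh ?T k (Suc (k - 1))"
    using assms(1) by (intro mesh_mono) auto
  have width: "mesh ?T k (Suc (k - 1)) - mesh ?T k (k - 1) = ?h"
    by (simp only: mesh_Suc add_diff_cancel_left')
  \<comment> \<open>With c the last difference quotient, integrating |c|^2 <= 2|c - v|^2 + 2|v|^2
    over the last cell gives |c|^2 <= (\<epsilon> + 2 \<open>?B\<close>) / \<open>?h\<close>; then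
    |c| <= 1 + |c|^2 is used. The bound is independent of z.\<close>
  have "norm (z k - z (k - 1)) \<le> ?h * (1 + (\<epsilon> + 2 * ?B) / ?h)" if "S_disc P zbar k z \<le> \<epsilon> / 2" for z
  proof -
    define c where "c = (z k - z (k - 1)) /\<^sub>R ?h"
    have err: "((\<lambda>t. (norm (c - ?V t))\<^sup>2) has_integral velocity_error ?T k z ?V (k - 1)) ?S"
      using has_integral_velocity_error[OF assms(1,2) k(1), of z] unfolding c_def k(2) .
    have int: "((\<lambda>t. 2 * (norm (c - ?V t))\<^sup>2 + 2 * (norm (?V t))\<^sup>2) has_integral
        2 * velocity_error ?T k z ?V (k - 1) + 2 * ?B) ?S"
      by (intro has_integral_add has_integral_mult_right err W12_cell(2)[OF assms(1,2) k(1)])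
    have const: "((\<lambda>t. (norm c)\<^sup>2) has_integral ?h * (norm c)\<^sup>2) ?S"
      using has_integral_const_real[of "(norm c)\<^sup>2" "mesh ?T k (k - 1)" "mesh ?T k (Suc (k - 1))"] le width
      by simp
    have le: "(norm c)\<^sup>2 \<le> 2 * (norm (c - v))\<^sup>2 + 2 * (norm v)\<^sup>2" for v
    proof -
      have "norm c \<le> norm (c - v) + norm v"
        using norm_triangle_ineq[of "c - v" v] by simp
      then have "(norm c)\<^sup>2 \<le> (norm (c - v) + norm v)\<^sup>2"
        by (intro power_mono) auto
      also have "\<dots> \<le> 2 * (norm (c - v))\<^sup>2 + 2 * (norm v)\<^sup>2"
        using zero_le_power2[of "norm (c - v) - norm v"] by (simp add: power2_eq_square algebra_simps)
      finally show ?thesis .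
    qed
    have "?h * (norm c)\<^sup>2 \<le> 2 * velocity_error ?T k z ?V (k - 1) + 2 * ?B"
      by (rule has_integral_le[OF const int le])
    moreover have "velocity_error ?T k z ?V (k - 1) \<le> S_disc P zbar k z"
      unfolding S_disc_eq[OF assms(1,2)]
      by (rule member_le_sum) (use k velocity_error_nonneg in auto)
    ultimately have "?h * (norm c)\<^sup>2 \<le> \<epsilon> + 2 * ?B"
      using that by linarith
    then have "(norm c)\<^sup>2 \<le> (\<epsilon> + 2 * ?B) / ?h"
      using h by (simp add: pos_le_divide_eq mult.commute)
    moreover have "norm c \<le> 1 + (norm c)\<^sup>2"
      using zero_le_power2[of "norm c - 1/2"] by (simp add: power2_eq_square algebra_simps)
    ultimately have "?h * norm c \<le> ?h * (1 + (\<epsilon> + 2 * ?B) / ?h)"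
      using h by (intro mult_left_mono) auto
    moreover have "z k - z (k - 1) = ?h *\<^sub>R c"
      using h by (simp add: c_def)
    ultimately show ?thesis
      using h by simp
  qed
  then show ?thesis by blast
qed

lemma closed_Collect_ball: "(\<And>i. i \<in> I \<Longrightarrow> closed {z. Q i z}) \<Longrightarrow> closed {z. \<forall>i\<in>I. Q i z}"
  unfolding Collect_ball_eq by (rule closed_INT) blast

text \<open>Entries beyond k do not enter the problem; fixing them at 0 is what makes the set
  bounded in every coordinate.\<close>

lemma compact_feasible_disc:
  fixes P :: "('n::finite, 'd::finite) sweeping"
  assumes "standing P" "H1 P" and W: "W12 (horizon P) zbar" and k: "0 < k"
  shows "compact {z. feasible_disc P zbar \<epsilon> mt ek k z \<and> (\<forall>j>k. z j = 0)}" (is "compact ?S")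
proof -
  let ?T = "horizon P"
  have T: "0 < ?T" using assms(1) by (simp add: standing_def)
  have h: "0 < mesh_step ?T k" using T k by (rule mesh_step_pos)
  have con: "continuous_on UNIV (con P i)" if "i \<in> {1..ncon P}" for i
    using assms(1) that by (intro convex_on_continuous) (auto simp: standing_def)
  obtain r where r: "\<And>z. S_disc P zbar k z \<le> \<epsilon> / 2 \<Longrightarrow> norm (z k - z (k - 1)) \<le> r"
    using last_node_bound[OF T W k] by blast
  \<comment> \<open>Radii by index: the localization for j < k, one further increment of size at
    most r for j = k, and 0 for the fixed tail.\<close>
  define R where "R j = (if j < k then norm (zbar (mesh ?T k j)) + \<epsilon> / 2
    else if j = k then r + (norm (zbar (mesh ?T k (k - 1))) + \<epsilon> / 2) else 0)" for j
  have "closed {z. feasible_disc P zbar \<epsilon> mt ek k z \<and> (\<forall>j>k. z j = 0)}"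
  proof -
    have g: "closed {z :: nat \<Rightarrow> ('n, 'd) state. 0 \<le> con P i (x_of (z k) - u_of (z k))}"
      if "i \<in> {1..ncon P}" for i
      by (intro closed_Collect_le continuous_on_const continuous_on_compose2[OF con[OF that]]
          continuous_intros) auto
    have inclusion: "closed {z :: nat \<Rightarrow> ('n, 'd) state. \<forall>j\<in>{..<k}.
        x_of (z (j + 1)) \<in> (\<lambda>w. x_of (z j) - mesh_step ?T k *\<^sub>R w) ` F_map P (z j)}"
      by (rule closed_Collect_ball) (rule closed_inclusion_step[OF assms(1,2) h])
    have initial: "closed {z :: nat \<Rightarrow> ('n, 'd) state. z 0 = (x_init P, u_of (zbar 0), a_of (zbar 0))}"
      by (intro closed_Collect_eq continuous_on_node continuous_on_const)
    have final: "closed {z :: nat \<Rightarrow> ('n, 'd) state. \<forall>i\<in>{1..ncon P}. 0 \<le> con P i (x_of (z k) - u_of (z k))}"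
      by (rule closed_Collect_ball) (rule g)
    have control: "closed {z :: nat \<Rightarrow> ('n, 'd) state.
        \<forall>j\<in>{..k}. r_min P - ek \<le> norm (u_of (z j)) \<and> norm (u_of (z j)) \<le> r_max P + ek}"
      by (rule closed_Collect_ball) (intro closed_Collect_conj closed_Collect_le continuous_intros)
    have near: "closed {z :: nat \<Rightarrow> ('n, 'd) state. \<forall>j\<in>{..<k}. norm (z j - zbar (mesh ?T k j)) \<le> \<epsilon> / 2}"
      by (rule closed_Collect_ball) (intro closed_Collect_le continuous_intros)
    have sublevel: "closed {z :: nat \<Rightarrow> ('n, 'd) state. S_disc P zbar k z \<le> \<epsilon> / 2}"
      "closed {z :: nat \<Rightarrow> ('n, 'd) state. du0 (mesh_step ?T k) z \<le> mt + 1}"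
      "closed {z :: nat \<Rightarrow> ('n, 'd) state. ddu (mesh_step ?T k) k z \<le> mt + 1}"
      by (intro closed_Collect_le continuous_on_const continuous_on_S_disc[OF T W]
          continuous_on_du0 continuous_on_ddu)+
    have tail: "closed {z :: nat \<Rightarrow> ('n, 'd) state. \<forall>j\<in>{k<..}. z j = 0}"
      by (rule closed_Collect_ball) (intro closed_Collect_eq continuous_on_node continuous_on_const)
    show ?thesis
      using closed_Int[OF inclusion closed_Int[OF initial closed_Int[OF final closed_Int[OF control
        closed_Int[OF near closed_Int[OF sublevel(1) closed_Int[OF sublevel(2)
        closed_Int[OF sublevel(3) tail]]]]]]]]
      unfolding feasible_disc_def Let_def Collect_conj_eq[symmetric] Ball_def lessThan_iff atMost_iff greaterThan_iff
      by (simp only: conj_assoc)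
  qed
  moreover have "z j \<in> cball 0 (R j)" if z: "feasible_disc P zbar \<epsilon> mt ek k z" "\<forall>j>k. z j = 0" for z j
  proof -
    have near: "norm (z i) \<le> norm (zbar (mesh ?T k i)) + \<epsilon> / 2" if "i < k" for i
    proof -
      have "norm (z i - zbar (mesh ?T k i)) \<le> \<epsilon> / 2"
        using z(1) that by (simp add: feasible_disc_def Let_def)
      then show ?thesis
        using norm_triangle_ineq2[of "z i" "zbar (mesh ?T k i)"] by linarith
    qed
    have "S_disc P zbar k z \<le> \<epsilon> / 2"
      using z(1) by (simp add: feasible_disc_def Let_def)
    then have "norm (z k) \<le> r + (norm (zbar (mesh ?T k (k - 1))) + \<epsilon> / 2)"
      using r[of z] near[of "k - 1"] k norm_triangle_ineq2[of "z k" "z (k - 1)"] by simp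
    then show ?thesis
      using near[of j] z(2) by (cases j k rule: linorder_cases) (auto simp: R_def)
  qed
  ultimately have "closed ?S" "?S \<subseteq> {z. \<forall>j. z j \<in> cball 0 (R j)}"
    by blast+
  then show ?thesis
    using closed_Int_compact[of ?S "{z. \<forall>j. z j \<in> cball 0 (R j)}"]
      compact_coordinatewise[of "\<lambda>j. cball 0 (R j)"]
    by (simp add: Int_absorb2)
qed

text \<open>Justifies cutting processes off after index k. Positivity of k puts node 1, which
  \<open>du0\<close> reads, within range.\<close>

lemma feasible_disc_cong:
  assumes "\<And>j. j \<le> k \<Longrightarrow> z j = w j" "0 < k"
  shows "S_disc P zbar k z = S_disc P zbar k w" "du0 h z = du0 h w" "ddu h k z = ddu h k w"
    "feasible_disc P zbar \<epsilon> mt ek k z = feasible_disc P zbar \<epsilon> mt ek k w"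
    "J_disc P zbar mt k z = J_disc P zbar mt k w"
proof -
  have [simp]: "z j = w j" if "j \<le> k" for j using assms(1) that by blast
  show [simp]: "S_disc P zbar k z = S_disc P zbar k w"
    unfolding S_disc_def Let_def by (intro sum.cong refl) simp
  show [simp]: "du0 h z = du0 h w" for h
    using assms(2) unfolding du0_def by simp
  show [simp]: "ddu h k z = ddu h k w" for h
    unfolding ddu_def by (intro sum.cong refl) simp
  show "feasible_disc P zbar \<epsilon> mt ek k z = feasible_disc P zbar \<epsilon> mt ek k w"
    unfolding feasible_disc_def Let_def by (simp cong: conj_cong imp_cong)
  have "(\<Sum>j<k. run_cost P (mesh (horizon P) k j) (z j) ((z (j + 1) - z j) /\<^sub>R mesh_step (horizon P) k))
    = (\<Sum>j<k. run_cost P (mesh (horizon P) k j) (w j) ((w (j + 1) - w j) /\<^sub>R mesh_step (horizon P) k))"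
    by (intro sum.cong refl) simp
  then show "J_disc P zbar mt k z = J_disc P zbar mt k w"
    unfolding J_disc_def Let_def by simp
qed

section \<open>Lower semicontinuity of the discrete cost and existence of minimizers\<close>

lemma lsc_J_disc:
  fixes P :: "('n::finite, 'd::finite) sweeping"
  assumes T: "0 < horizon P" and W: "W12 (horizon P) zbar" and H4: "H4 P" and M: "lsc_at_mesh P" and k: "0 < k"
  shows "lsc (J_disc P zbar mt k)"
proof -
  let ?h = "mesh_step (horizon P) k"
  let ?r = "\<lambda>j (z :: nat \<Rightarrow> ('n, 'd) state). run_cost P (mesh (horizon P) k j) (z j) ((z (j + 1) - z j) /\<^sub>R ?h)"
  have h: "0 < ?h" using T k by (rule mesh_step_pos)
  have t: "term_cost P x \<noteq> - \<infinity>" for x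
    using H4 by (simp add: H4_def)
  \<comment> \<open>(H4) excludes minus infinity at every time in the interval, hence at the mesh
    points too.\<close>
  have r: "?r j z \<noteq> - \<infinity>" if "j \<in> {..<k}" for j z
  proof -
    have "mesh (horizon P) k j \<in> {0..horizon P}"
      using that T k by (intro mesh_in_interval) auto
    then show ?thesis using H4 unfolding H4_def by blast
  qed
  have rs: "ereal ?h * (\<Sum>j<k. ?r j z) \<noteq> - \<infinity>" for z
  proof -
    have "(\<Sum>j<k. ?r j z) \<noteq> - \<infinity>" by (intro ereal_sum_not_MInf r)
    then show ?thesis using h by (cases "\<Sum>j<k. ?r j z") auto
  qed
  have "lsc (term_cost P)" using H4 by (simp add: H4_def)
  then have lt: "lsc (\<lambda>z :: nat \<Rightarrow> ('n, 'd) state. term_cost P (x_of (z k)))"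
    by (rule lsc_compose) (intro continuous_intros)
  have "lsc (?r j)" if "j \<in> {..<k}" for j
  proof -
    have "lsc (\<lambda>(z, v). run_cost P (mesh (horizon P) k j) z v)"
      using M k that by (simp add: lsc_at_mesh_def)
    from lsc_compose[OF this, of "\<lambda>z. (z j, (z (j + 1) - z j) /\<^sub>R ?h)"]
    show ?thesis by (simp add: continuous_intros)
  qed
  then have lr: "lsc (\<lambda>z. ereal ?h * (\<Sum>j<k. ?r j z))"
    using h r by (intro lsc_cmult lsc_sum) auto
  have lS: "lsc (\<lambda>z. ereal (S_disc P zbar k z))"
    by (intro lsc_ereal continuous_on_S_disc T W)
  have l1: "lsc (\<lambda>z :: nat \<Rightarrow> ('n, 'd) state. ereal ((infdist (du0 ?h z) {..mt})\<^sup>2))"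
    by (intro lsc_ereal continuous_intros continuous_on_du0)
  have l2: "lsc (\<lambda>z :: nat \<Rightarrow> ('n, 'd) state. ereal ((infdist (ddu ?h k z) {..mt})\<^sup>2))"
    by (intro lsc_ereal continuous_intros continuous_on_ddu)
  show ?thesis
    unfolding J_disc_def[abs_def] Let_def
    by (intro lsc_add lt lr lS l1 l2) (use t rs in auto)
qed

text \<open>A minimizer is found among the processes that vanish after index k. It beats every
  competitor, since cutting a competitor off preserves feasibility and cost.\<close>

lemma optimal_disc_exists:
  assumes "standing P" "H1 P" "H4 P" "lsc_at_mesh P" and W: "W12 (horizon P) zbar" and k: "0 < k"
    and w: "feasible_disc P zbar \<epsilon> mt ek k w"
  shows "\<exists>z. optimal_disc P zbar \<epsilon> mt ek k z"
proof -
  let ?S = "{z. feasible_disc P zbar \<epsilon> mt ek k z \<and> (\<forall>j>k. z j = 0)}"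
  let ?cut = "\<lambda>z j. if j \<le> k then z j else 0"
  have T: "0 < horizon P" using assms(1) by (simp add: standing_def)
  have cut: "?cut z \<in> ?S" "J_disc P zbar mt k (?cut z) = J_disc P zbar mt k z"
    if "feasible_disc P zbar \<epsilon> mt ek k z" for z
    using that feasible_disc_cong(4,5)[of k "?cut z" z] k by auto
  have "\<exists>z\<in>?S. \<forall>y\<in>?S. J_disc P zbar mt k z \<le> J_disc P zbar mt k y"
    using cut(1)[OF w]
    by (intro lsc_attains_inf compact_feasible_disc lsc_J_disc assms T k W) blast
  then show ?thesis
    unfolding optimal_disc_def using cut by (metis (no_types, lifting) mem_Collect_eq)
qed

section \<open>Feasibility of the nodes of a close approximating trajectory\<close>

lemma feasible_nodes:
  fixes P :: "('n::finite, 'd::finite) sweeping"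
  assumes T: "0 < horizon P" and zbar: "feasible P zbar" and "0 < \<epsilon>" "0 < k"
    and lin: "piecewise_linear (horizon P) k z" and z0: "z 0 = zbar 0"
    and close: "W12_dist_sq (horizon P) z zbar \<le> \<epsilon> / 2" "W12_dist_sq (horizon P) z zbar \<le> \<epsilon>\<^sup>2 / (4 * horizon P)"
    and bounds: "\<forall>j\<le>k. r_min P - ek \<le> norm (u_of (z (mesh (horizon P) k j))) \<and> norm (u_of (z (mesh (horizon P) k j))) \<le> r_max P + ek"
    and incl: "\<forall>j<k. x_of (z (mesh (horizon P) k (j + 1))) \<in>
      (\<lambda>w. x_of (z (mesh (horizon P) k j)) - mesh_step (horizon P) k *\<^sub>R w) ` F_map P (z (mesh (horizon P) k j))"
    and final: "\<forall>j\<le>k. x_of (z (mesh (horizon P) k j)) - u_of (z (mesh (horizon P) k j)) \<in> C_set P"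
    and du: "norm ((u_of (z (mesh (horizon P) k 1)) - u_of (z (mesh (horizon P) k 0))) /\<^sub>R mesh_step (horizon P) k) \<le> mt"
    and var: "var_dot (horizon P) (\<lambda>s. u_of (z s)) \<le> ereal mt"
  shows "feasible_disc P zbar \<epsilon> mt ek k (\<lambda>j. z (mesh (horizon P) k j))"
proof -
  let ?T = "horizon P"
  let ?w = "\<lambda>j. z (mesh ?T k j)"
  have W: "W12 ?T zbar" and x0: "x_of (zbar 0) = x_init P"
    using zbar by (simp_all add: feasible_def)
  let ?S = "\<Sum>j<k. velocity_error ?T k ?w (time_deriv ?T zbar) j"
  have S: "?S \<le> W12_dist_sq ?T z zbar"
    by (rule sum_velocity_error_le_W12_dist_sq[OF T W \<open>0 < k\<close> lin])
  have near: "norm (?w j - zbar (mesh ?T k j)) \<le> \<epsilon> / 2" if "j < k" for j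
  proof -
    \<comment> \<open>This \<delta> balances \<open>node_dist_le\<close>: both \<delta>T and, by the
      second closeness bound \<epsilon>^2/(4T) = \<delta>\<epsilon>/2, the error term divided by
      \<delta> are at most \<epsilon>/2.\<close>
    define \<delta> where "\<delta> = \<epsilon> / (2 * ?T)"
    have \<delta>: "0 < \<delta>" using T \<open>0 < \<epsilon>\<close> by (simp add: \<delta>_def)
    have dist: "norm (?w j - zbar (mesh ?T k j)) \<le> (\<delta> * ?T + ?S / \<delta>) / 2"
      using node_dist_le[OF T W _ \<delta>, of ?w j k] z0 that by simp
    have len: "\<delta> * ?T = \<epsilon> / 2"
      using T by (simp add: \<delta>_def)
    have err: "?S / \<delta> \<le> \<epsilon> / 2"
    proof -
      have "?S \<le> \<epsilon>\<^sup>2 / (4 * ?T)"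
        using S close(2) by linarith
      also have "\<dots> = \<epsilon> / 2 * \<delta>"
        by (simp add: \<delta>_def power2_eq_square)
      finally show ?thesis
        using \<delta> by (simp only: pos_divide_le_eq)
    qed
    have "(\<delta> * ?T + ?S / \<delta>) / 2 \<le> (\<epsilon> / 2 + \<epsilon> / 2) / 2"
      unfolding len by (intro divide_right_mono add_left_mono err) simp
    with dist show ?thesis by (simp only: field_sum_of_halves)
  qed
  have S_le: "S_disc P zbar k ?w \<le> \<epsilon> / 2"
    using S close(1) by (simp add: S_disc_eq[OF T W])
  have ddu: "ddu (mesh_step ?T k) k ?w \<le> mt + 1"
  proof -
    have "piecewise_linear ?T k (\<lambda>s. u_of (z s))"
      unfolding piecewise_linear_def
    proof (intro allI impI ballI)
      fix j t assume "j < k" "t \<in> {mesh ?T k j..mesh ?T k (Suc j)}"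
      with lin have "z t = z (mesh ?T k j)
          + ((t - mesh ?T k j) / mesh_step ?T k) *\<^sub>R (z (mesh ?T k (Suc j)) - z (mesh ?T k j))"
        unfolding piecewise_linear_def by blast
      from arg_cong[OF this, of u_of]
      show "u_of (z t) = u_of (z (mesh ?T k j)) + ((t - mesh ?T k j) / mesh_step ?T k) *\<^sub>R
          (u_of (z (mesh ?T k (Suc j))) - u_of (z (mesh ?T k j)))"
        by simp
    qed
    then have "ereal (ddu (mesh_step ?T k) k ?w) \<le> var_dot ?T (\<lambda>s. u_of (z s))"
      by (rule ddu_le_var_dot[OF T \<open>0 < k\<close>]) (rule refl)
    from order_trans[OF this var]
    show ?thesis by simp
  qed
  have du0: "du0 (mesh_step ?T k) ?w \<le> mt + 1"
    using du unfolding du0_def by linarith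
  have init: "?w 0 = (x_init P, u_of (zbar 0), a_of (zbar 0))"
  proof -
    have "?w 0 = (x_of (zbar 0), u_of (zbar 0), a_of (zbar 0))"
      using z0 by simp
    then show ?thesis unfolding x0 .
  qed
  have con: "\<forall>i\<in>{1..ncon P}. 0 \<le> con P i (x_of (?w k) - u_of (?w k))"
    using final by (simp add: C_set_def C_comp_def)
  show ?thesis
    unfolding feasible_disc_def Let_def
    using near by (intro conjI incl init con bounds S_le du0 ddu) blast
qed

theorem proposition5p1:
  fixes P :: "('n::finite, 'd::finite) sweeping"
    and zbar :: "real \<Rightarrow> ('n, 'd) state"
    and \<epsilon> \<mu> K :: real and e :: "nat \<Rightarrow> real"
  assumes "standing P"
    and "rilm P \<epsilon> zbar"
    and "H1 P" and "H2 P" and "H3 P" and "H4 P"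
    and "lsc_at_mesh P"
    and "mesh_assm P zbar \<mu>"
    and "approximation_constants P zbar \<mu> K e"
  shows "\<forall>\<^sub>F k in sequentially. \<exists>z. optimal_disc P zbar \<epsilon> (mu_tilde (horizon P) \<mu> K) (e k) k z"
proof -
  let ?T = "horizon P"
  have T: "0 < ?T" using assms(1) by (simp add: standing_def)
  have zbar: "feasible P zbar" and "0 < \<epsilon>"
    using assms(2) by (simp_all add: rilm_def)
  then have W: "W12 ?T zbar" by (simp add: feasible_def)
  obtain zz where lim: "(\<lambda>k. W12_dist_sq ?T (zz k) zbar) \<longlonglongrightarrow> 0"
    and zz: "\<forall>k\<ge>1. 0 < e k \<and> e k \<le> 2 * mesh_step ?T k * \<mu> * exp K
      \<and> piecewise_linear ?T k (zz k) \<and> zz k 0 = zbar 0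
      \<and> (\<forall>j\<le>k. r_min P - e k \<le> norm (u_of (zz k (mesh ?T k j))) \<and> norm (u_of (zz k (mesh ?T k j))) \<le> r_max P + e k)
      \<and> (\<forall>j<k. x_of (zz k (mesh ?T k (j + 1))) \<in>
          (\<lambda>w. x_of (zz k (mesh ?T k j)) - mesh_step ?T k *\<^sub>R w) ` F_map P (zz k (mesh ?T k j)))
      \<and> (\<forall>j\<le>k. x_of (zz k (mesh ?T k j)) - u_of (zz k (mesh ?T k j)) \<in> C_set P)
      \<and> norm ((u_of (zz k (mesh ?T k 1)) - u_of (zz k (mesh ?T k 0))) /\<^sub>R mesh_step ?T k) \<le> mu_tilde ?T \<mu> K
      \<and> var_dot ?T (\<lambda>s. u_of (zz k s)) \<le> ereal (mu_tilde ?T \<mu> K)"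
    using assms(9) unfolding approximation_constants_def Let_def by (elim exE conjE) (rule that)
  \<comment> \<open>The two closeness bounds required by \<open>feasible_nodes\<close>: one for the
    constraint on S_k, one for the distance at the nodes.\<close>
  have "0 < min (\<epsilon> / 2) (\<epsilon>\<^sup>2 / (4 * ?T))"
    using T \<open>0 < \<epsilon>\<close> by simp
  from order_tendstoD(2)[OF lim this] eventually_ge_at_top[of 1]
  show ?thesis
  proof eventually_elim
    case (elim k)
    note zzk = zz[rule_format, OF elim(2)]
    have k: "0 < k" and close: "W12_dist_sq ?T (zz k) zbar \<le> \<epsilon> / 2"
      "W12_dist_sq ?T (zz k) zbar \<le> \<epsilon>\<^sup>2 / (4 * ?T)"
      using elim by simp_all
    from zzk have "feasible_disc P zbar \<epsilon> (mu_tilde ?T \<mu> K) (e k) k (\<lambda>j. zz k (mesh ?T k j))"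
      by (elim conjE) (rule feasible_nodes[OF T zbar \<open>0 < \<epsilon>\<close> k _ _ close])
    then show ?case
      by (rule optimal_disc_exists[OF assms(1,3,6,7) W k])
  qed
qed

end
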